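(* Fix a horizon $\epsilon>0$ and initial data $\mathbf u_0,\mathbf v_0\in\dot L^2(D;\mathbb R^2)$. The initial value problem $$\rho\,\ddot{\mathbf u}(\mathbf x,t)=\mathcal L^\epsilon(\mathbf u)(\mathbf x,t)+\mathbf b(\mathbf x,t),\quad\mathbf x\in D,\qquad \mathbf u(\mathbf x,0)=\mathbf u_0(\mathbf x),\quad\partial_t\mathbf u(\mathbf x,0)=\mathbf v_0(\mathbf x),$$ where $$\mathcal L^\epsilon(\mathbf u)(\mathbf x,t)=\int_{\mathcal H_\epsilon(\mathbf x)\cap D}2\,\partial_S\mathcal W^\epsilon(S(\mathbf y,\mathbf x,\mathbf u(t)))\,\mathbf e_{\mathbf y-\mathbf x}\,d\mathbf y,$$ has a unique solution $\mathbf u(\mathbf x,t)$ such that for every $t\in[0,T]$, $\mathbf u$ takes values in $\dot L^2(D;\mathbb R^2)$ and $\mathbf u$ belongs to the space $C^2([0,T];\dot L^2(D;\mathbb R^2))$.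
   Context: Domain. $R=\{0<x_1<a,\ -b/2<x_2<b/2\}$; the notch is $C=\{0\le x_1\le \ell(0)-d,\ -d<x_2<d\}\cup\{\ell(0)-d\le x_1\le \ell(0)-d+\sqrt{d^2-x_2^2},\ -d<x_2<d\}$; $D=R\setminus C$. Strain. $S(\mathbf y,\mathbf x,\mathbf u(t))=\frac{\mathbf u(\mathbf y,t)-\mathbf u(\mathbf x,t)}{|\mathbf y-\mathbf x|}\cdot\mathbf e_{\mathbf y-\mathbf x}$, $\mathbf e_{\mathbf y-\mathbf x}=\frac{\mathbf y-\mathbf x}{|\mathbf y-\mathbf x|}$. Potential. $J^\epsilon(r)=J(r/\epsilon)$ with $J(r)=0$ for $r\ge1$ and $0\le J(r)\le M_J<\infty$ for $r<1$. $\omega_2$ is the area of the unit disk, $\mathcal H_\epsilon(\mathbf x)$ the disk of radius $\epsilon$ centered at $\mathbf x$. $\mathcal W^\epsilon(S(\mathbf y,\mathbf x,\mathbf u(t)))=\frac{J^\epsilon(|\mathbf y-\mathbf x|)}{\epsilon^3\omega_2|\mathbf y-\mathbf x|}\,g(\sqrt{|\mathbf y-\mathbf x|}\,S(\mathbf y,\mathbf x,\mathbf u(t)))$ and $\partial_S\mathcal W^\epsilon(S)=\frac{1}{\epsilon^3\omega_2}\frac{J^\epsilon(|\mathbf y-\mathbf x|)}{|\mathbf y-\mathbf x|}\partial_S g(\sqrt{|\mathbf y-\mathbf x|}S)$, where $g(r)=h(r^2)$ with $h$ concave, $g$ bounded and smooth, $g(0)=g'(0)=0$, $g$ convex-concave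 with inflection points $\pm r^c$ ($r^c>0$), $\lim_{|r|\to\infty}g(r)=C^+$, and $g'$ goes smoothly to zero at $\pm r^+$ ($r^+>r^c$). Convention for $\mathcal H_\epsilon(\mathbf x)\cap D$: if the segment from $\mathbf x$ to $\mathbf y$ crosses $\partial D$, the strain and energy of that pair are set to zero. Body force. $\rho>0$ is constant. With $\mathbf e^2$ the vertical unit vector and $\delta>0$: $\mathbf b=\mathbf e^2\delta^{-1}g_+(x_1,t)$ on $\{0<x_1<a,\ b/2-\delta<x_2<b/2\}$, $\mathbf b=\mathbf e^2\delta^{-1}g_-(x_1,t)$ on $\{0<x_1<a,\ -b/2<x_2<-b/2+\delta\}$, $\mathbf b=0$ elsewhere, where $g_\pm$ are smooth in $x_1$ and $t$, $g_-=-g_+$, $g_+>0$, and $\sup_{t\in[0,T]}\|\mathbf b(\cdot,t)\|_{L^2(D;\mathbb R^2)}^2<\infty$. Spaces. $\dot L^2(D;\mathbb R^2)$ is the subspace of $L^2(D;\mathbb R^2)$ of fields that are $L^2$-orthogonal to all in-plane rigid motions $\Omega\times\mathbf x+\mathbf c$ ($\Omega,\mathbf c$ constant). $C^2([0,T];\dot L^2(D;\mathbb R^2))$ is the standard space of twice continuously differentiable functions of $t$ with values in $\dot L^2(D;\mathbb R^2)$, with $\mathbf v,\dot{\mathbf v},\ddot{\mathbf v}$ having finite supremum over $0\le t\le T$ of the $L^2(D;\mathbb R^2)$ norm. *)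

theory Defs
  imports "HOL-Analysis.Analysis"
begin

section \<open>Smooth functions\<close>

text \<open>
  Derivatives are taken within \<open>S\<close>, and are one-sided at boundary points of \<open>S\<close>. The notion
  is meant for sets such as \<open>UNIV\<close> or nondegenerate closed boxes, where the derivative within
  \<open>S\<close> is unique. In finite dimension, differentiability of all iterated directional derivatives
  is the same as being infinitely often continuously differentiable.
\<close>

fun k_times_differentiable_on ::
  "nat \<Rightarrow> 'a::real_normed_vector set \<Rightarrow> ('a \<Rightarrow> 'b::real_normed_vector) \<Rightarrow> bool" where
  "k_times_differentiable_on 0 S f \<longleftrightarrow> continuous_on S f"
| "k_times_differentiable_on (Suc k) S f \<longleftrightarrow>
     f differentiable_on S \<and>
     (\<forall>v. k_times_differentiable_on k S (\<lambda>x. frechet_derivative f (at x within S) v))"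

definition smooth_on :: "'a::real_normed_vector set \<Rightarrow> ('a \<Rightarrow> 'b::real_normed_vector) \<Rightarrow> bool" where
  "smooth_on S f \<longleftrightarrow> (\<forall>k. k_times_differentiable_on k S f)"


section \<open>The notched plate\<close>

definition plate :: "real \<Rightarrow> real \<Rightarrow> (real^2) set" where
  "plate a b = {x. 0 < x$1 \<and> x$1 < a \<and> - b/2 < x$2 \<and> x$2 < b/2}"

definition notch :: "real \<Rightarrow> real \<Rightarrow> (real^2) set" where
  "notch l0 d =
     {x. 0 \<le> x$1 \<and> x$1 \<le> l0 - d \<and> - d < x$2 \<and> x$2 < d} \<union>
     {x. l0 - d \<le> x$1 \<and> x$1 \<le> l0 - d + sqrt (d\<^sup>2 - (x$2)\<^sup>2) \<and> - d < x$2 \<and> x$2 < d}"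

definition notched_plate :: "real \<Rightarrow> real \<Rightarrow> real \<Rightarrow> real \<Rightarrow> (real^2) set" where
  "notched_plate a b l0 d = plate a b - notch l0 d"


section \<open>Square integrable fields modulo rigid motions\<close>

text \<open>
  Elements of \<open>L\<^sup>2\<close> are represented by functions; equality in \<open>L\<^sup>2\<close> is equality almost
  everywhere, and limits are limits in the seminorm \<open>L2_norm\<close>.
\<close>

definition L2 :: "(real^2) set \<Rightarrow> (real^2 \<Rightarrow> real^2) set" where
  "L2 D = {f. f \<in> borel_measurable (lebesgue_on D) \<and>
              integrable (lebesgue_on D) (\<lambda>x. (norm (f x))\<^sup>2)}"

definition L2_norm :: "(real^2) set \<Rightarrow> (real^2 \<Rightarrow> real^2) \<Rightarrow> real" where
  "L2_norm D f = sqrt (LINT x|lebesgue_on D. (norm (f x))\<^sup>2)"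

text \<open>
  The in-plane rigid motion \<open>\<Omega> \<times> x + c\<close>, where \<open>\<Omega>\<close> is the out-of-plane component of the
  rotation vector.
\<close>

definition rigid_motion :: "real \<Rightarrow> real^2 \<Rightarrow> real^2 \<Rightarrow> real^2" where
  "rigid_motion \<Omega> c x = vector [- \<Omega> * x$2, \<Omega> * x$1] + c"

definition L2dot :: "(real^2) set \<Rightarrow> (real^2 \<Rightarrow> real^2) set" where
  "L2dot D = {f \<in> L2 D. \<forall>\<Omega> c. (LINT x|lebesgue_on D. f x \<bullet> rigid_motion \<Omega> c x) = 0}"

definition L2_continuous_on ::
  "(real^2) set \<Rightarrow> real set \<Rightarrow> (real \<Rightarrow> real^2 \<Rightarrow> real^2) \<Rightarrow> bool" where
  "L2_continuous_on D I u \<longleftrightarrow>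
     (\<forall>t\<in>I. ((\<lambda>s. L2_norm D (\<lambda>x. u s x - u t x)) \<longlongrightarrow> 0) (at t within I))"

definition L2_derivative_on ::
  "(real^2) set \<Rightarrow> real set \<Rightarrow> (real \<Rightarrow> real^2 \<Rightarrow> real^2) \<Rightarrow> (real \<Rightarrow> real^2 \<Rightarrow> real^2) \<Rightarrow> bool" where
  "L2_derivative_on D I u v \<longleftrightarrow>
     (\<forall>t\<in>I. ((\<lambda>s. L2_norm D (\<lambda>x. (u s x - u t x) /\<^sub>R (s - t) - v t x)) \<longlongrightarrow> 0) (at t within I))"

text \<open>
  \<open>C2_L2dot D T u v w\<close>: the field \<open>u\<close> belongs to \<open>C\<^sup>2([0,T]; L2dot D)\<close>, with first and
  second time derivatives \<open>v\<close> and \<open>w\<close>.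
\<close>

definition C2_L2dot ::
  "(real^2) set \<Rightarrow> real \<Rightarrow> (real \<Rightarrow> real^2 \<Rightarrow> real^2) \<Rightarrow> (real \<Rightarrow> real^2 \<Rightarrow> real^2) \<Rightarrow>
   (real \<Rightarrow> real^2 \<Rightarrow> real^2) \<Rightarrow> bool" where
  "C2_L2dot D T u v w \<longleftrightarrow>
     (\<forall>t\<in>{0..T}. u t \<in> L2dot D \<and> v t \<in> L2dot D \<and> w t \<in> L2dot D) \<and>
     L2_derivative_on D {0..T} u v \<and>
     L2_derivative_on D {0..T} v w \<and>
     L2_continuous_on D {0..T} w \<and>
     bdd_above ((\<lambda>t. L2_norm D (u t)) ` {0..T}) \<and>
     bdd_above ((\<lambda>t. L2_norm D (v t)) ` {0..T}) \<and>
     bdd_above ((\<lambda>t. L2_norm D (w t)) ` {0..T})"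


section \<open>Nonlocal strain, potential and force\<close>

definition unit_dir :: "real^2 \<Rightarrow> real^2 \<Rightarrow> real^2" where
  "unit_dir y x = (y - x) /\<^sub>R norm (y - x)"

text \<open>Segments that only touch the boundary without crossing it form a null set of pairs.\<close>

definition crosses_boundary :: "(real^2) set \<Rightarrow> real^2 \<Rightarrow> real^2 \<Rightarrow> bool" where
  "crosses_boundary D y x \<longleftrightarrow> closed_segment x y \<inter> frontier D \<noteq> {}"

definition strain :: "(real^2) set \<Rightarrow> real^2 \<Rightarrow> real^2 \<Rightarrow> (real^2 \<Rightarrow> real^2) \<Rightarrow> real" where
  "strain D y x u =
     (if crosses_boundary D y x then 0
      else ((u y - u x) /\<^sub>R norm (y - x)) \<bullet> unit_dir y x)"

definition energy ::
  "(real^2) set \<Rightarrow> (real \<Rightarrow> real) \<Rightarrow> (real \<Rightarrow> real) \<Rightarrow> real \<Rightarrow> real^2 \<Rightarrow> real^2 \<Rightarrow> real \<Rightarrow> real" where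
  "energy D J g \<epsilon> y x S =
     (if crosses_boundary D y x then 0
      else J (norm (y - x) / \<epsilon>) / (\<epsilon>^3 * measure lebesgue (ball (0::real^2) 1) * norm (y - x))
             * g (sqrt (norm (y - x)) * S))"

definition nonlocal_force ::
  "(real^2) set \<Rightarrow> (real \<Rightarrow> real) \<Rightarrow> (real \<Rightarrow> real) \<Rightarrow> real \<Rightarrow> (real^2 \<Rightarrow> real^2) \<Rightarrow> real^2 \<Rightarrow> real^2" where
  "nonlocal_force D J g \<epsilon> u x =
     (LINT y:ball x \<epsilon> \<inter> D|lebesgue.
        (2 * deriv (energy D J g \<epsilon> y x) (strain D y x u)) *\<^sub>R unit_dir y x)"


section \<open>Body force and initial value problem\<close>

text \<open>
  For \<open>\<delta> \<le> b/2\<close> the two boundary layers are disjoint and the sum is the usual definition by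
  cases. The arguments of \<open>gp\<close> and \<open>gm\<close> are \<open>(x\<^sub>1, t)\<close>.
\<close>

definition body_force ::
  "real \<Rightarrow> real \<Rightarrow> real \<Rightarrow> (real \<times> real \<Rightarrow> real) \<Rightarrow> (real \<times> real \<Rightarrow> real) \<Rightarrow>
   real^2 \<Rightarrow> real \<Rightarrow> real^2" where
  "body_force a b \<delta> gp gm x t =
     (if 0 < x$1 \<and> x$1 < a \<and> b/2 - \<delta> < x$2 \<and> x$2 < b/2
      then (gp (x$1, t) / \<delta>) *\<^sub>R axis 2 1 else 0) +
     (if 0 < x$1 \<and> x$1 < a \<and> - b/2 < x$2 \<and> x$2 < - b/2 + \<delta>
      then (gm (x$1, t) / \<delta>) *\<^sub>R axis 2 1 else 0)"

definition is_solution ::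
  "(real^2) set \<Rightarrow> (real \<Rightarrow> real) \<Rightarrow> (real \<Rightarrow> real) \<Rightarrow> real \<Rightarrow> real \<Rightarrow> (real^2 \<Rightarrow> real \<Rightarrow> real^2) \<Rightarrow>
   (real^2 \<Rightarrow> real^2) \<Rightarrow> (real^2 \<Rightarrow> real^2) \<Rightarrow> real \<Rightarrow> (real \<Rightarrow> real^2 \<Rightarrow> real^2) \<Rightarrow> bool" where
  "is_solution D J g \<epsilon> \<rho> F u0 v0 T u \<longleftrightarrow>
     (\<exists>v w. C2_L2dot D T u v w \<and>
       (\<forall>t\<in>{0..T}. AE x in lebesgue_on D.
          \<rho> *\<^sub>R w t x = nonlocal_force D J g \<epsilon> (u t) x + F x t) \<and>
       (AE x in lebesgue_on D. u 0 x = u0 x) \<and>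
       (AE x in lebesgue_on D. v 0 x = v0 x))"

end

theory Submission
  imports Defs
begin

text \<open>
  The equation of motion is an ordinary differential equation in \<open>L\<^sup>2(D)\<close> whose right-hand side is
  globally Lipschitz. Indeed, boundedness and concavity force \<open>g\<close> to be constant beyond \<open>r\<^sub>p\<close>, so
  \<open>deriv g\<close> is bounded and Lipschitz, and the difference of two force densities is at most a multiple
  of \<open>(\<bar>u x - v x\<bar> + \<bar>u y - v y\<bar>) / \<bar>y - x\<bar>\<close> on \<open>\<bar>y - x\<bar> < \<epsilon>\<close>. This weight is integrable in the
  plane, so Schur's test gives the Lipschitz bound, and Picard iteration yields a unique solution of
  the first order system for \<open>(u, \<partial>\<^sub>t u)\<close>. Rigid motions are invisible to the strain, and the force
  density is antisymmetric in \<open>(x, y)\<close>, so the nonlocal force is orthogonal to rigid motions; the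
  body force is, because it is odd and \<open>D\<close> is even under \<open>x\<^sub>2 \<mapsto> - x\<^sub>2\<close>. Hence \<open>\<partial>\<^sub>t u\<close>, and then
  \<open>u\<close>, stay orthogonal to rigid motions.
\<close>

section \<open>The Hilbert space of square integrable fields\<close>

text \<open>A difficulty of representation shapes the development. Fields are functions, time
  derivatives are taken in a seminorm, and \<open>L2 D\<close> is a set rather than a type with a
  norm, so a fixed point theorem for Banach spaces does not apply to them directly. Picard iteration
  is run instead in the Hilbert space of classes on the whole plane, with a force that sees only the
  restriction of its argument to \<open>D\<close>. The resulting curve is projected back to
  \<open>D\<close>, representatives are chosen at each time, and a dictionary translates continuity
  and derivatives of classes into the seminorm notions. Uniqueness uses the dictionary in the other
  direction: a competing solution becomes a solution of the abstract equation. Orthogonality to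
  rigid motions is not built into the iteration space; it is recovered from the equation.

  The only singularity is the prefactor \<open>1 / norm (y - x)\<close> of the potential. The factor
  \<open>sqrt (norm (y - x))\<close> enters the force twice, inside \<open>deriv g\<close> and by
  the chain rule, and these two absorb the further \<open>1 / norm (y - x)\<close> carried by the
  strain.\<close>

definition square_integrable :: "'a measure \<Rightarrow> ('a \<Rightarrow> 'b::euclidean_space) \<Rightarrow> bool" where
  "square_integrable M f \<longleftrightarrow> f \<in> borel_measurable M \<and> integrable M (\<lambda>x. (norm (f x))\<^sup>2)"

lemma L2_iff: "f \<in> L2 D \<longleftrightarrow> square_integrable (lebesgue_on D) f"
  by (simp add: L2_def square_integrable_def)

lemma square_integrable_inner:
  assumes "square_integrable M f" "square_integrable M g"
  shows "integrable M (\<lambda>x. f x \<bullet> g x)"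
proof (rule Bochner_Integration.integrable_bound)
  show "integrable M (\<lambda>x. (norm (f x))\<^sup>2 + (norm (g x))\<^sup>2)"
    using assms by (auto simp: square_integrable_def)
  show "(\<lambda>x. f x \<bullet> g x) \<in> borel_measurable M"
    using assms by (auto simp: square_integrable_def)
  show "AE x in M. norm (f x \<bullet> g x) \<le> norm ((norm (f x))\<^sup>2 + (norm (g x))\<^sup>2)"
  proof (rule AE_I2)
    fix x
    have "norm (f x \<bullet> g x) \<le> norm (f x) * norm (g x)"
      by (simp add: Cauchy_Schwarz_ineq2)
    also have "\<dots> \<le> (norm (f x))\<^sup>2 + (norm (g x))\<^sup>2"
      using sum_squares_bound[of "norm (f x)" "norm (g x)"]
        mult_nonneg_nonneg[OF norm_ge_zero[of "f x"] norm_ge_zero[of "g x"]] by linarith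
    finally show "norm (f x \<bullet> g x) \<le> norm ((norm (f x))\<^sup>2 + (norm (g x))\<^sup>2)" by simp
  qed
qed

lemma square_integrable_add:
  assumes "square_integrable M f" "square_integrable M g"
  shows "square_integrable M (\<lambda>x. f x + g x)"
proof -
  have "(norm (f x + g x))\<^sup>2 = (norm (f x))\<^sup>2 + 2 * (f x \<bullet> g x) + (norm (g x))\<^sup>2" for x
    by (simp add: power2_norm_eq_inner algebra_simps inner_commute)
  then show ?thesis
    using assms square_integrable_inner[OF assms] by (auto simp: square_integrable_def)
qed

lemma square_integrable_scaleR:
  "square_integrable M f \<Longrightarrow> square_integrable M (\<lambda>x. c *\<^sub>R f x)"
  by (auto simp: square_integrable_def power_mult_distrib)

lemma square_integrable_diff:
  assumes "square_integrable M f" "square_integrable M g"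
  shows "square_integrable M (\<lambda>x. f x - g x)"
  using square_integrable_add[OF assms(1) square_integrable_scaleR[OF assms(2), of "-1"]] by simp

lemma square_integrable_uminus: "square_integrable M f \<Longrightarrow> square_integrable M (\<lambda>x. - f x)"
  using square_integrable_scaleR[of M f "-1"] by simp

lemma square_integrable_zero: "square_integrable M (\<lambda>x. 0)"
  by (simp add: square_integrable_def)

section \<open>Completeness of the square integrable functions\<close>

lemma square_integrable_if_nn_integral_finite:
  assumes "f \<in> borel_measurable M" "(\<integral>\<^sup>+x. ennreal ((norm (f x))\<^sup>2) \<partial>M) < \<infinity>"
  shows "square_integrable M f"
  using assms by (auto simp: square_integrable_def integrable_iff_bounded)

lemma nn_integral_norm_square:
  assumes "square_integrable M f"
  shows "(\<integral>\<^sup>+x. ennreal ((norm (f x))\<^sup>2) \<partial>M) = ennreal (LINT x|M. (norm (f x))\<^sup>2)"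
  using assms by (intro nn_integral_eq_integral) (auto simp: square_integrable_def)

lemma square_integrable_AE_zero_iff:
  assumes "square_integrable M f"
  shows "(LINT x|M. f x \<bullet> f x) = 0 \<longleftrightarrow> (AE x in M. f x = 0)"
  using integral_nonneg_eq_0_iff_AE[of M "\<lambda>x. (norm (f x))\<^sup>2"] assms
  by (simp add: square_integrable_def power2_norm_eq_inner)

text \<open>The weight \<open>2^n\<close> splits the decay. Since
  \<open>2^n * (1/8)^n = (1/4)^n\<close> is still summable, the weighted sum of squared increments
  is finite almost everywhere; at such a point the weight bounds the n-th increment by a multiple of
  \<open>(sqrt (1/2))^n\<close>, and the telescoping series converges absolutely.\<close>

lemma L2_Cauchy_subsequence:
  fixes f :: "nat \<Rightarrow> 'a \<Rightarrow> 'b::euclidean_space"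
  assumes meas [measurable]: "\<And>n. f n \<in> borel_measurable M"
    and bound: "\<And>n. (\<integral>\<^sup>+x. ennreal ((norm (f (Suc n) x - f n x))\<^sup>2) \<partial>M) \<le> ennreal ((1/8)^n)"
  shows "AE x in M. convergent (\<lambda>n. f n x)"
proof -
  have "(\<integral>\<^sup>+x. (\<Sum>n. ennreal (2^n * (norm (f (Suc n) x - f n x))\<^sup>2)) \<partial>M)
      = (\<Sum>n. ennreal (2^n) * (\<integral>\<^sup>+x. ennreal ((norm (f (Suc n) x - f n x))\<^sup>2) \<partial>M))"
    by (simp add: nn_integral_suminf nn_integral_cmult ennreal_mult)
  also have "\<dots> \<le> (\<Sum>n. ennreal ((1/4)^n))"
  proof (rule suminf_le)
    fix n :: nat
    have "ennreal (2^n) * (\<integral>\<^sup>+x. ennreal ((norm (f (Suc n) x - f n x))\<^sup>2) \<partial>M)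
        \<le> ennreal (2^n) * ennreal ((1/8)^n)"
      by (rule mult_left_mono[OF bound]) simp
    also have "\<dots> = ennreal (2^n * (1/8)^n)" by (simp add: ennreal_mult)
    also have "\<dots> = ennreal ((1/4)^n)" by (simp flip: power_mult_distrib)
    finally show "ennreal (2^n) * (\<integral>\<^sup>+x. ennreal ((norm (f (Suc n) x - f n x))\<^sup>2) \<partial>M)
        \<le> ennreal ((1/4)^n)" .
  qed auto
  also have "\<dots> = ennreal (\<Sum>n. (1/4)^n)"
    by (rule suminf_ennreal2) (simp, rule summable_geometric, simp)
  also have "\<dots> < \<infinity>"
    by simp
  finally have "(\<integral>\<^sup>+x. (\<Sum>n. ennreal (2^n * (norm (f (Suc n) x - f n x))\<^sup>2)) \<partial>M) \<noteq> \<infinity>"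
    by auto
  then have "AE x in M. (\<Sum>n. ennreal (2^n * (norm (f (Suc n) x - f n x))\<^sup>2)) \<noteq> \<infinity>"
    by (intro nn_integral_noteq_infinite) auto
  then show ?thesis
  proof eventually_elim
    case (elim x)
    define G where "G = (\<Sum>n. 2^n * (norm (f (Suc n) x - f n x))\<^sup>2)"
    have "summable (\<lambda>n. 2^n * (norm (f (Suc n) x - f n x))\<^sup>2)"
      using elim by (intro summable_suminf_not_top) auto
    then have le: "2^n * (norm (f (Suc n) x - f n x))\<^sup>2 \<le> G" for n
      unfolding G_def using sum_le_suminf[of "\<lambda>n. 2^n * (norm (f (Suc n) x - f n x))\<^sup>2" "{n}"]
      by simp
    have "summable (\<lambda>n. f (Suc n) x - f n x)"
    proof (rule summable_comparison_test')
      show "summable (\<lambda>n. sqrt G * (sqrt (1/2))^n)"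
        by (intro summable_mult summable_geometric) (simp add: real_sqrt_divide)
      fix n :: nat
      have "(norm (f (Suc n) x - f n x))\<^sup>2 \<le> G * (1/2)^n"
        using le[of n] by (simp add: field_simps power_one_over)
      then have "norm (f (Suc n) x - f n x) \<le> sqrt (G * (1/2)^n)"
        by (rule real_le_rsqrt)
      then show "norm (f (Suc n) x - f n x) \<le> sqrt G * (sqrt (1/2))^n"
        by (simp add: real_sqrt_mult real_sqrt_power)
    qed
    then have "convergent (\<lambda>n. \<Sum>i<n. f (Suc i) x - f i x)"
      by (simp add: summable_iff_convergent)
    then have "convergent (\<lambda>n. f n x - f 0 x)"
      using sum_lessThan_telescope[of "\<lambda>i. f i x"] by simp
    from convergent_add[OF this convergent_const[of "f 0 x"]] show ?case
      by simp
  qed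
qed

text \<open>A rapidly converging subsequence has a pointwise limit almost everywhere, and Fatou's
  lemma carries the Cauchy estimate against a fixed \<open>f n\<close> over to that limit. This
  gives convergence of the full sequence at once.\<close>

lemma Riesz_Fischer:
  fixes f :: "nat \<Rightarrow> 'a \<Rightarrow> 'b::euclidean_space"
  assumes meas [measurable]: "\<And>n. f n \<in> borel_measurable M"
    and Cauchy: "\<And>e. e > 0 \<Longrightarrow>
      \<exists>N. \<forall>m\<ge>N. \<forall>n\<ge>N. (\<integral>\<^sup>+x. ennreal ((norm (f m x - f n x))\<^sup>2) \<partial>M) \<le> ennreal e"
  obtains F where "F \<in> borel_measurable M"
    and "\<And>e. e > 0 \<Longrightarrow> \<exists>N. \<forall>n\<ge>N. (\<integral>\<^sup>+x. ennreal ((norm (F x - f n x))\<^sup>2) \<partial>M) \<le> ennreal e"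
proof -
  obtain N where N: "\<And>e m n. e > 0 \<Longrightarrow> m \<ge> N e \<Longrightarrow> n \<ge> N e \<Longrightarrow>
      (\<integral>\<^sup>+x. ennreal ((norm (f m x - f n x))\<^sup>2) \<partial>M) \<le> ennreal e"
    using Cauchy by metis
  \<comment> \<open>The sum makes \<open>r\<close> monotone and at least \<open>N ((1/8)^k)\<close>;
    the summand \<open>k\<close> makes it unbounded, so that late members of the subsequence pass
    every threshold \<open>N e\<close>.\<close>
  define r where "r k = k + (\<Sum>i\<le>k. N ((1/8)^i))" for k :: nat
  have r_ge: "N ((1/8)^k) \<le> r k" for k
    using member_le_sum[of k "{..k}" "\<lambda>i. N ((1/8)^i)"] by (simp add: r_def)
  have r_ge': "k \<le> r k" and r_Suc: "r k \<le> r (Suc k)" for k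
    by (simp_all add: r_def)
  have conv: "AE x in M. convergent (\<lambda>k. f (r k) x)"
  proof (rule L2_Cauchy_subsequence)
    fix k
    show "(\<integral>\<^sup>+x. ennreal ((norm (f (r (Suc k)) x - f (r k) x))\<^sup>2) \<partial>M) \<le> ennreal ((1/8)^k)"
      using r_ge order_trans[OF r_ge r_Suc] by (intro N) simp_all
  qed measurable
  \<comment> \<open>Where the subsequence diverges, \<open>lim\<close> has an unspecified value;
    this concerns only a null set.\<close>
  define F where "F x = lim (\<lambda>k. f (r k) x)" for x
  have [measurable]: "F \<in> borel_measurable M"
    unfolding F_def by (rule borel_measurable_lim_metric) measurable
  have *: "(\<integral>\<^sup>+x. ennreal ((norm (F x - f n x))\<^sup>2) \<partial>M) \<le> ennreal e"
    if "e > 0" "n \<ge> N e" for e n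
  proof -
    have "(\<integral>\<^sup>+x. ennreal ((norm (F x - f n x))\<^sup>2) \<partial>M)
        = (\<integral>\<^sup>+x. liminf (\<lambda>k. ennreal ((norm (f (r k) x - f n x))\<^sup>2)) \<partial>M)"
    proof (intro nn_integral_cong_AE, use conv in eventually_elim)
      case (elim x)
      then have "(\<lambda>k. f (r k) x) \<longlonglongrightarrow> F x"
        by (simp add: F_def convergent_LIMSEQ_iff)
      then have "(\<lambda>k. ennreal ((norm (f (r k) x - f n x))\<^sup>2)) \<longlonglongrightarrow> ennreal ((norm (F x - f n x))\<^sup>2)"
        by (intro tendsto_intros)
      from lim_imp_Liminf[OF sequentially_bot this] show ?case by simp
    qed
    also have "\<dots> \<le> liminf (\<lambda>k. \<integral>\<^sup>+x. ennreal ((norm (f (r k) x - f n x))\<^sup>2) \<partial>M)"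
      by (rule nn_integral_liminf) measurable
    also have "\<dots> \<le> liminf (\<lambda>k::nat. ennreal e)"
    proof (rule Liminf_mono)
      show "\<forall>\<^sub>F k in sequentially.
          (\<integral>\<^sup>+x. ennreal ((norm (f (r k) x - f n x))\<^sup>2) \<partial>M) \<le> ennreal e"
        using eventually_ge_at_top[of "N e"]
      proof eventually_elim
        case (elim k)
        then show ?case using that r_ge'[of k] by (intro N) auto
      qed
    qed
    finally show ?thesis by (simp add: Liminf_const)
  qed
  show thesis
  proof (rule that)
    show "\<exists>N. \<forall>n\<ge>N. (\<integral>\<^sup>+x. ennreal ((norm (F x - f n x))\<^sup>2) \<partial>M) \<le> ennreal e" if "e > 0" for e
      using *[OF that] by blast
  qed measurable
qed

section \<open>The Hilbert space of classes modulo null sets\<close>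

definition l2_rel :: "('a::euclidean_space \<Rightarrow> 'b::euclidean_space) \<Rightarrow> ('a \<Rightarrow> 'b) \<Rightarrow> bool" where
  "l2_rel f g \<longleftrightarrow> square_integrable lebesgue f \<and> square_integrable lebesgue g \<and>
     (AE x in lebesgue. f x = g x)"

\<comment> \<open>The relation is reflexive exactly on the square integrable functions, so the
  partial quotient selects these functions and identifies those equal almost everywhere in one
  construction.\<close>
quotient_type (overloaded) ('a, 'b) l2 =
  "'a::euclidean_space \<Rightarrow> 'b::euclidean_space" / partial: l2_rel
proof (rule part_equivpI)
  show "\<exists>f::'a \<Rightarrow> 'b. l2_rel f f"
    by (auto simp: l2_rel_def intro!: exI[of _ "\<lambda>_. 0"] square_integrable_zero)
  show "symp (l2_rel :: ('a \<Rightarrow> 'b) \<Rightarrow> _)"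
    by (auto simp: l2_rel_def symp_def)
  show "transp (l2_rel :: ('a \<Rightarrow> 'b) \<Rightarrow> _)"
    by (auto simp: l2_rel_def transp_def)
qed

lemma l2_rel_map2:
  fixes h :: "'b::euclidean_space \<Rightarrow> 'c::euclidean_space \<Rightarrow> 'd::euclidean_space"
    and f1 f2 :: "'a::euclidean_space \<Rightarrow> 'b" and g1 g2 :: "'a \<Rightarrow> 'c"
  assumes "l2_rel f1 f2" "l2_rel g1 g2"
    and "\<And>(f :: 'a \<Rightarrow> 'b) (g :: 'a \<Rightarrow> 'c). square_integrable lebesgue f \<Longrightarrow> square_integrable lebesgue g \<Longrightarrow>
      square_integrable lebesgue (\<lambda>x. h (f x) (g x))"
  shows "l2_rel (\<lambda>x. h (f1 x) (g1 x)) (\<lambda>x. h (f2 x) (g2 x))"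
proof -
  have "AE x in lebesgue. f1 x = f2 x" "AE x in lebesgue. g1 x = g2 x"
    using assms(1,2) by (simp_all add: l2_rel_def)
  then have "AE x in lebesgue. h (f1 x) (g1 x) = h (f2 x) (g2 x)"
    by eventually_elim simp
  then show ?thesis
    using assms(1,2) assms(3)[of f1 g1] assms(3)[of f2 g2] by (simp add: l2_rel_def)
qed

instantiation l2 :: (euclidean_space, euclidean_space) real_inner
begin

lift_definition zero_l2 :: "('a, 'b) l2" is "\<lambda>x. 0"
  by (simp add: l2_rel_def square_integrable_zero)

lift_definition plus_l2 :: "('a, 'b) l2 \<Rightarrow> ('a, 'b) l2 \<Rightarrow> ('a, 'b) l2" is "\<lambda>f g x. f x + g x"
  by (rule l2_rel_map2[where h = "(+)"]) (auto intro: square_integrable_add)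

lift_definition minus_l2 :: "('a, 'b) l2 \<Rightarrow> ('a, 'b) l2 \<Rightarrow> ('a, 'b) l2" is "\<lambda>f g x. f x - g x"
  by (rule l2_rel_map2[where h = "(-)"]) (auto intro: square_integrable_diff)

lift_definition scaleR_l2 :: "real \<Rightarrow> ('a, 'b) l2 \<Rightarrow> ('a, 'b) l2" is "\<lambda>c f x. c *\<^sub>R f x"
  by (rule l2_rel_map2[where h = "\<lambda>a b. _ *\<^sub>R a", OF _ _ square_integrable_scaleR])

lift_definition uminus_l2 :: "('a, 'b) l2 \<Rightarrow> ('a, 'b) l2" is "\<lambda>f x. - f x"
  by (rule l2_rel_map2[where h = "\<lambda>a b. - a" and ?g1.0 = "\<lambda>x. 0" and ?g2.0 = "\<lambda>x. 0", OF _ _ square_integrable_uminus])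
    (simp_all add: l2_rel_def square_integrable_zero)

lift_definition inner_l2 :: "('a, 'b) l2 \<Rightarrow> ('a, 'b) l2 \<Rightarrow> real" is
  "\<lambda>f g. LINT x|lebesgue. f x \<bullet> g x"
  unfolding l2_rel_def
proof (elim conjE, rule integral_cong_AE)
  fix f1 f2 g1 g2 :: "'a \<Rightarrow> 'b"
  assume "AE x in lebesgue. f1 x = f2 x" "AE x in lebesgue. g1 x = g2 x"
  then show "AE x in lebesgue. f1 x \<bullet> g1 x = f2 x \<bullet> g2 x"
    by eventually_elim simp
qed (auto simp: square_integrable_def)

definition norm_l2 :: "('a, 'b) l2 \<Rightarrow> real" where
  "norm_l2 f = sqrt (inner f f)"

definition dist_l2 :: "('a, 'b) l2 \<Rightarrow> ('a, 'b) l2 \<Rightarrow> real" where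
  "dist_l2 f g = norm (f - g)"

definition sgn_l2 :: "('a, 'b) l2 \<Rightarrow> ('a, 'b) l2" where
  "sgn_l2 f = scaleR (inverse (norm f)) f"

definition uniformity_l2 :: "(('a, 'b) l2 \<times> ('a, 'b) l2) filter" where
  "uniformity_l2 = (INF e\<in>{0<..}. principal {(f, g). dist f g < e})"

definition open_l2 :: "('a, 'b) l2 set \<Rightarrow> bool" where
  "open_l2 S \<longleftrightarrow> (\<forall>f\<in>S. \<forall>\<^sub>F (f', g) in uniformity. f' = f \<longrightarrow> g \<in> S)"

instance
proof
  fix f g h :: "('a, 'b) l2" and c d :: real
  show "f + g + h = f + (g + h)"
    by transfer (auto simp: l2_rel_def add.assoc intro!: square_integrable_add)
  show "f + g = g + f"
    by transfer (auto simp: l2_rel_def add.commute intro!: square_integrable_add)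
  show "0 + f = f"
    by transfer (auto simp: l2_rel_def)
  show "- f + f = 0"
    by transfer (auto simp: l2_rel_def square_integrable_zero)
  show "f - g = f + - g"
    by transfer (auto simp: l2_rel_def intro: square_integrable_diff)
  show "c *\<^sub>R (f + g) = c *\<^sub>R f + c *\<^sub>R g"
    by transfer (auto simp: l2_rel_def scaleR_add_right
        intro!: square_integrable_add square_integrable_scaleR)
  show "(c + d) *\<^sub>R f = c *\<^sub>R f + d *\<^sub>R f"
    by transfer (auto simp: l2_rel_def scaleR_add_left
        intro!: square_integrable_add square_integrable_scaleR)
  show "c *\<^sub>R d *\<^sub>R f = (c * d) *\<^sub>R f"
    by transfer (auto simp: l2_rel_def intro!: square_integrable_scaleR)
  show "1 *\<^sub>R f = f"
    by transfer (auto simp: l2_rel_def)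
  show "inner f g = inner g f"
    by transfer (simp add: inner_commute)
  show "inner (f + g) h = inner f h + inner g h"
    by transfer (simp add: l2_rel_def inner_add_left square_integrable_inner)
  show "inner (c *\<^sub>R f) g = c * inner f g"
    by transfer simp
  show "0 \<le> inner f f"
    by transfer simp
  \<comment> \<open>Definiteness is the axiom that forces the passage to classes: a function with
    vanishing square integral is zero only almost everywhere.\<close>
  show "inner f f = 0 \<longleftrightarrow> f = 0"
    by transfer (auto simp: l2_rel_def square_integrable_AE_zero_iff square_integrable_zero)
qed (rule norm_l2_def dist_l2_def sgn_l2_def uniformity_l2_def open_l2_def)+

end

lemma l2_cases:
  obtains f where "square_integrable lebesgue f" "F = abs_l2 f"
  using that[of "rep_l2 F"] Quotient3_rep_reflp[OF Quotient3_l2, of F]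
    Quotient3_abs_rep[OF Quotient3_l2, of F]
  by (simp add: l2_rel_def)

lemma norm_abs_l2:
  assumes "square_integrable lebesgue f"
  shows "(norm (abs_l2 f))\<^sup>2 = (LINT x|lebesgue. (norm (f x))\<^sup>2)"
  using assms by (simp add: power2_norm_eq_inner inner_l2.abs_eq l2_rel_def)

lemma abs_l2_diff:
  assumes "square_integrable lebesgue f" "square_integrable lebesgue g"
  shows "abs_l2 f - abs_l2 g = abs_l2 (\<lambda>x. f x - g x)"
  using assms by (simp add: minus_l2.abs_eq l2_rel_def)

lemma nn_integral_norm_abs_l2_diff:
  assumes "square_integrable lebesgue f" "square_integrable lebesgue g"
  shows "(\<integral>\<^sup>+x. ennreal ((norm (f x - g x))\<^sup>2) \<partial>lebesgue) = ennreal ((norm (abs_l2 f - abs_l2 g))\<^sup>2)"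
  using assms
  by (simp add: abs_l2_diff norm_abs_l2 nn_integral_norm_square square_integrable_diff)

instance l2 :: (euclidean_space, euclidean_space) banach
proof
  fix X :: "nat \<Rightarrow> ('a, 'b) l2"
  assume X: "Cauchy X"
  have "\<forall>n. \<exists>f. square_integrable lebesgue f \<and> X n = abs_l2 f"
    using l2_cases by metis
  then obtain f where f: "\<And>n. square_integrable lebesgue (f n)" "\<And>n. X n = abs_l2 (f n)"
    by metis
  have [measurable]: "f n \<in> borel_measurable lebesgue" for n
    using f by (simp add: square_integrable_def)
  have nn: "(\<integral>\<^sup>+x. ennreal ((norm (f m x - f n x))\<^sup>2) \<partial>lebesgue) = ennreal ((norm (X m - X n))\<^sup>2)" for m n
    using f by (simp add: nn_integral_norm_abs_l2_diff)
  have "\<exists>N. \<forall>m\<ge>N. \<forall>n\<ge>N. (\<integral>\<^sup>+x. ennreal ((norm (f m x - f n x))\<^sup>2) \<partial>lebesgue) \<le> ennreal e"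
    if "e > 0" for e
  proof -
    from X \<open>e > 0\<close> obtain N where N: "\<And>m n. m \<ge> N \<Longrightarrow> n \<ge> N \<Longrightarrow> norm (X m - X n) < sqrt e"
      using CauchyD[OF X, of "sqrt e"] by auto
    have "(norm (X m - X n))\<^sup>2 \<le> e" if "m \<ge> N" "n \<ge> N" for m n
      using power_mono[OF less_imp_le[OF N[OF that]], of 2] \<open>e > 0\<close> by simp
    then show ?thesis unfolding nn by (auto intro!: ennreal_leI)
  qed
  from Riesz_Fischer[OF _ this]
  obtain F where [measurable]: "F \<in> borel_measurable lebesgue"
    and F: "\<And>e. e > 0 \<Longrightarrow> \<exists>N. \<forall>n\<ge>N.
      (\<integral>\<^sup>+x. ennreal ((norm (F x - f n x))\<^sup>2) \<partial>lebesgue) \<le> ennreal e"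
    by auto
  \<comment> \<open>The limit \<open>F\<close> is so far only measurable. It is square integrable as
    the sum of \<open>F - f N\<close> and \<open>f N\<close>.\<close>
  from F[of 1] obtain N where "(\<integral>\<^sup>+x. ennreal ((norm (F x - f N x))\<^sup>2) \<partial>lebesgue) \<le> ennreal 1"
    by auto
  then have "square_integrable lebesgue (\<lambda>x. F x - f N x)"
    by (intro square_integrable_if_nn_integral_finite) (auto elim: order.strict_trans1)
  from square_integrable_add[OF this f(1)[of N]] have sF: "square_integrable lebesgue F"
    by simp
  have "X \<longlonglongrightarrow> abs_l2 F"
  proof (rule metric_LIMSEQ_I)
    fix e :: real assume "e > 0"
    with F[of "(e/2)\<^sup>2"] obtain N where N: "\<And>n. n \<ge> N \<Longrightarrow>
        (\<integral>\<^sup>+x. ennreal ((norm (F x - f n x))\<^sup>2) \<partial>lebesgue) \<le> ennreal ((e/2)\<^sup>2)"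
      by auto
    have "norm (abs_l2 F - X n) \<le> e / 2" if "n \<ge> N" for n
    proof (rule power2_le_imp_le)
      show "(norm (abs_l2 F - X n))\<^sup>2 \<le> (e / 2)\<^sup>2"
        using N[OF that] by (simp add: f nn_integral_norm_abs_l2_diff[OF sF f(1)] del: power_divide)
    qed (use \<open>e > 0\<close> in auto)
    then show "\<exists>N. \<forall>n\<ge>N. dist (X n) (abs_l2 F) < e"
      using \<open>e > 0\<close> by (intro exI[of _ N]) (fastforce simp: dist_norm norm_minus_commute)
  qed
  then show "convergent X" by (auto simp: convergent_def)
qed

section \<open>Global Picard iteration\<close>

lemma continuous_on_Lipschitz_compose:
  fixes F :: "real \<Rightarrow> 'a::real_normed_vector \<Rightarrow> 'b::real_normed_vector"
  assumes Lip: "\<And>t x y. t \<in> I \<Longrightarrow> norm (F t x - F t y) \<le> L * norm (x - y)"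
    and cont: "\<And>x. continuous_on I (\<lambda>t. F t x)" and y: "continuous_on I y"
  shows "continuous_on I (\<lambda>t. F t (y t))"
  unfolding continuous_on_def
proof
  fix t assume t: "t \<in> I"
  have "((\<lambda>s. F s (y s) - F s (y t)) \<longlongrightarrow> 0) (at t within I)"
  proof (rule Lim_null_comparison)
    show "\<forall>\<^sub>F s in at t within I. norm (F s (y s) - F s (y t)) \<le> L * norm (y s - y t)"
      using Lip by (auto simp: eventually_at_filter)
    have "(y \<longlongrightarrow> y t) (at t within I)"
      using y t by (simp add: continuous_on_def)
    then have "((\<lambda>s. L * norm (y s - y t)) \<longlongrightarrow> L * norm (y t - y t)) (at t within I)"
      by (intro tendsto_intros)
    then show "((\<lambda>s. L * norm (y s - y t)) \<longlongrightarrow> 0) (at t within I)" by simp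
  qed
  moreover have "((\<lambda>s. F s (y t)) \<longlongrightarrow> F t (y t)) (at t within I)"
    using cont t by (simp add: continuous_on_def)
  ultimately have "((\<lambda>s. (F s (y s) - F s (y t)) + F s (y t)) \<longlongrightarrow> 0 + F t (y t)) (at t within I)"
    by (rule tendsto_add)
  then show "((\<lambda>s. F s (y s)) \<longlongrightarrow> F t (y t)) (at t within I)" by simp
qed

text \<open>The complete space for the fixed point argument consists of bounded continuous functions
  on all of \<open>real\<close>. Functions on \<open>{0..T}\<close> enter it by freezing time at the
  endpoints, and compactness supplies boundedness.\<close>

lemma bcontfun_clamp:
  fixes f :: "real \<Rightarrow> 'a::metric_space"
  assumes "T \<ge> 0" "continuous_on {0..T} f"
  shows "(\<lambda>t. f (max 0 (min T t))) \<in> bcontfun"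
proof -
  have sub: "(\<lambda>t. max 0 (min T t)) ` UNIV \<subseteq> {0..T}"
    using assms by auto
  have "continuous_on UNIV (f \<circ> (\<lambda>t. max 0 (min T t)))"
    by (intro continuous_on_compose continuous_intros continuous_on_subset[OF assms(2) sub])
  moreover have "bounded (f ` {0..T})"
    using assms by (intro compact_imp_bounded compact_continuous_image) auto
  then have "bounded (range (f \<circ> (\<lambda>t. max 0 (min T t))))"
    by (rule bounded_subset) (use sub in \<open>auto simp: image_comp[symmetric]\<close>)
  ultimately show ?thesis
    by (simp add: bcontfun_def comp_def)
qed

text \<open>The rate \<open>2 * L\<close> is chosen because \<open>L * exp (2 * L * s)\<close> has
  the antiderivative \<open>exp (2 * L * s) / 2\<close>; this is the origin of the contraction
  factor \<open>1 / 2\<close>. The contribution \<open>- B / 2\<close> of the lower endpoint has a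
  favourable sign and is dropped.\<close>

lemma integral_exp_le:
  fixes f :: "real \<Rightarrow> 'a::banach"
  assumes "L > 0" "\<tau> \<ge> 0" "continuous_on {0..\<tau>} f"
    and "\<And>s. s \<in> {0..\<tau>} \<Longrightarrow> norm (f s) \<le> L * exp (2 * L * s) * B" "B \<ge> 0"
  shows "norm (integral {0..\<tau>} f) \<le> exp (2 * L * \<tau>) * (B / 2)"
proof -
  have *: "((\<lambda>s. L * exp (2 * L * s) * B) has_integral
      (exp (2 * L * \<tau>) * (B / 2) - exp (2 * L * 0) * (B / 2))) {0..\<tau>}"
  proof (rule fundamental_theorem_of_calculus)
    fix s assume "s \<in> {0..\<tau>}"
    show "((\<lambda>s. exp (2 * L * s) * (B / 2)) has_vector_derivative L * exp (2 * L * s) * B)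
        (at s within {0..\<tau>})"
      unfolding has_real_derivative_iff_has_vector_derivative[symmetric]
      by (auto intro!: derivative_eq_intros)
  qed fact
  have "norm (integral {0..\<tau>} f) \<le> integral {0..\<tau>} (\<lambda>s. L * exp (2 * L * s) * B)"
    by (intro integral_norm_bound_integral integrable_continuous_real assms
        has_integral_integrable[OF *])
  also have "\<dots> = exp (2 * L * \<tau>) * (B / 2) - B / 2"
    using integral_unique[OF *] by simp
  finally show ?thesis using \<open>B \<ge> 0\<close> by simp
qed

text \<open>Picard iteration for the rescaled unknown \<open>exp (- 2 * L * t) *\<^sub>R Z t\<close> contracts the sup
  norm by \<open>1 / 2\<close> on the whole interval, whatever its length.\<close>

lemma Picard_Lindelof_global:
  fixes F :: "real \<Rightarrow> 'a::banach \<Rightarrow> 'a"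
  assumes T: "T \<ge> 0" and L: "L > 0"
    and Lip: "\<And>t x y. t \<in> {0..T} \<Longrightarrow> norm (F t x - F t y) \<le> L * norm (x - y)"
    and cont: "\<And>x. continuous_on {0..T} (\<lambda>t. F t x)"
  obtains Z where "Z 0 = z0"
    and "\<And>t. t \<in> {0..T} \<Longrightarrow> (Z has_vector_derivative F t (Z t)) (at t within {0..T})"
    and "\<And>X t. X 0 = z0 \<Longrightarrow>
      (\<And>t. t \<in> {0..T} \<Longrightarrow> (X has_vector_derivative F t (X t)) (at t within {0..T})) \<Longrightarrow>
      t \<in> {0..T} \<Longrightarrow> X t = Z t"
proof -
  define c where "c t = max 0 (min T t)" for t
  have c: "c t \<in> {0..T}" and c_id: "t \<in> {0..T} \<Longrightarrow> c t = t" for t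
    using T by (auto simp: c_def)
  have contF: "continuous_on {0..T} (\<lambda>s. F s (y s))" if "continuous_on {0..T} y" for y
    using continuous_on_Lipschitz_compose[of "{0..T}" F, OF Lip cont that] .
  define G where "G Y t = exp (- 2 * L * t) *\<^sub>R
    (z0 + integral {0..t} (\<lambda>s. F s (exp (2 * L * s) *\<^sub>R apply_bcontfun Y s)))" for Y t
  have contFY: "continuous_on {0..T} (\<lambda>s. F s (exp (2 * L * s) *\<^sub>R apply_bcontfun Y s))" for Y
    by (intro contF continuous_intros continuous_on_apply_bcontfun)
  have "continuous_on {0..T} (G Y)" for Y
    unfolding G_def
    by (intro continuous_intros indefinite_integral_continuous_1 integrable_continuous_real contFY)
  then have bc: "(\<lambda>t. G Y (c t)) \<in> bcontfun" for Y
    unfolding c_def using T by (intro bcontfun_clamp)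
  define P where "P Y = Bcontfun (\<lambda>t. G Y (c t))" for Y
  have P: "apply_bcontfun (P Y) t = G Y (c t)" for Y t
    by (simp add: P_def Bcontfun_inverse bc)
  have "\<exists>!Y. P Y = Y"
  proof (rule banach_fix_type[where c = "1/2"])
    have "dist (P Y) (P Y') \<le> 1/2 * dist Y Y'" for Y Y'
    proof (rule dist_bound)
      fix t
      define \<tau> where "\<tau> = c t"
      have \<tau>: "\<tau> \<ge> 0" "{0..\<tau>} \<subseteq> {0..T}" using c[of t] by (auto simp: \<tau>_def)
      let ?f = "\<lambda>Y s. F s (exp (2 * L * s) *\<^sub>R apply_bcontfun Y s)"
      have cf: "continuous_on {0..\<tau>} (?f Y)" for Y
        using contFY \<tau> continuous_on_subset by blast
      have "norm (integral {0..\<tau>} (\<lambda>s. ?f Y s - ?f Y' s)) \<le> exp (2 * L * \<tau>) * (dist Y Y' / 2)"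
      proof (rule integral_exp_le[OF L \<tau>(1)])
        show "continuous_on {0..\<tau>} (\<lambda>s. ?f Y s - ?f Y' s)"
          by (intro continuous_intros cf)
        fix s assume "s \<in> {0..\<tau>}"
        then have "norm (?f Y s - ?f Y' s)
            \<le> L * norm (exp (2 * L * s) *\<^sub>R apply_bcontfun Y s - exp (2 * L * s) *\<^sub>R apply_bcontfun Y' s)"
          using \<tau> by (intro Lip) auto
        also have "\<dots> = L * exp (2 * L * s) * dist (apply_bcontfun Y s) (apply_bcontfun Y' s)"
          by (simp add: dist_norm flip: scaleR_diff_right)
        also have "\<dots> \<le> L * exp (2 * L * s) * dist Y Y'"
          using L by (intro mult_left_mono dist_bounded) auto
        finally show "norm (?f Y s - ?f Y' s) \<le> L * exp (2 * L * s) * dist Y Y'" .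
      qed simp
      moreover have "integral {0..\<tau>} (\<lambda>s. ?f Y s - ?f Y' s)
          = integral {0..\<tau>} (?f Y) - integral {0..\<tau>} (?f Y')"
        by (intro Henstock_Kurzweil_Integration.integral_diff integrable_continuous_real cf)
      moreover have "dist (P Y t) (P Y' t)
          = exp (- 2 * L * \<tau>) * norm (integral {0..\<tau>} (?f Y) - integral {0..\<tau>} (?f Y'))"
        by (simp add: P G_def \<tau>_def dist_norm flip: scaleR_diff_right)
      ultimately have "dist (P Y t) (P Y' t) \<le> exp (- 2 * L * \<tau>) * (exp (2 * L * \<tau>) * (dist Y Y' / 2))"
        by (simp add: mult_left_mono)
      also have "\<dots> = 1/2 * dist Y Y'"
        by (simp add: mult.assoc[symmetric] flip: exp_add)
      finally show "dist (P Y t) (P Y' t) \<le> 1/2 * dist Y Y'" .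
    qed
    then show "\<forall>Y Y'. dist (P Y) (P Y') \<le> 1/2 * dist Y Y'" by blast
  qed auto
  then obtain Y where Y: "P Y = Y" and uniq: "\<And>Y'. P Y' = Y' \<Longrightarrow> Y' = Y" by blast
  define Z where "Z t = exp (2 * L * t) *\<^sub>R apply_bcontfun Y t" for t
  have Z_eq: "Z t = z0 + integral {0..t} (\<lambda>s. F s (Z s))" if "t \<in> {0..T}" for t
  proof -
    have "apply_bcontfun Y t = G Y t" using P[of Y t] Y c_id[OF that] by simp
    then show ?thesis by (simp add: Z_def G_def flip: exp_add)
  qed
  have contFZ: "continuous_on {0..T} (\<lambda>s. F s (Z s))"
    unfolding Z_def by (rule contFY)
  show thesis
  proof (rule that)
    show "Z 0 = z0" using Z_eq[of 0] T by simp
    show "(Z has_vector_derivative F t (Z t)) (at t within {0..T})" if t: "t \<in> {0..T}" for t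
    proof (rule has_vector_derivative_transform[OF t])
      show "((\<lambda>t. z0 + integral {0..t} (\<lambda>s. F s (Z s))) has_vector_derivative F t (Z t)) (at t within {0..T})"
        using has_vector_derivative_add[OF has_vector_derivative_const
            integral_has_vector_derivative[OF contFZ t]] by simp
    qed (use Z_eq in simp)
    fix X t
    assume X0: "X 0 = z0" and t: "t \<in> {0..T}"
      and X: "\<And>t. t \<in> {0..T} \<Longrightarrow> (X has_vector_derivative F t (X t)) (at t within {0..T})"
    \<comment> \<open>A competitor satisfies the integral equation by the fundamental theorem of
      calculus. Rescaled and clamped, it is therefore a fixed point of \<open>P\<close>, and so it
      coincides with \<open>Y\<close>.\<close>
    have X_eq: "X t = z0 + integral {0..t} (\<lambda>s. F s (X s))" if "t \<in> {0..T}" for t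
    proof -
      have "((\<lambda>s. F s (X s)) has_integral (X t - X 0)) {0..t}"
        using that by (intro fundamental_theorem_of_calculus
            has_vector_derivative_within_subset[OF X]) auto
      then show ?thesis using X0 by (simp add: integral_unique)
    qed
    have "continuous_on {0..T} X"
      using X has_vector_derivative_continuous continuous_on_eq_continuous_within by blast
    then have bc_X: "(\<lambda>t. exp (- 2 * L * c t) *\<^sub>R X (c t)) \<in> bcontfun"
      unfolding c_def using T
      by (intro bcontfun_clamp[where f = "\<lambda>t. exp (- 2 * L * t) *\<^sub>R X t"] continuous_intros)
    define Y' where "Y' = Bcontfun (\<lambda>t. exp (- 2 * L * c t) *\<^sub>R X (c t))"
    have Y': "apply_bcontfun Y' t = exp (- 2 * L * c t) *\<^sub>R X (c t)" for t
      unfolding Y'_def by (subst Bcontfun_inverse[OF bc_X]) (rule refl)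
    have "P Y' = Y'"
    proof (rule bcontfun_eqI)
      fix t
      have "integral {0..c t} (\<lambda>s. F s (exp (2 * L * s) *\<^sub>R apply_bcontfun Y' s))
          = integral {0..c t} (\<lambda>s. F s (X s))"
        using c[of t] by (intro Henstock_Kurzweil_Integration.integral_cong)
          (simp add: Y' c_id flip: exp_add)
      then show "apply_bcontfun (P Y') t = apply_bcontfun Y' t"
        using X_eq[OF c[of t]] by (simp add: P G_def Y')
    qed
    then have "Y' = Y" by (rule uniq)
    then show "X t = Z t"
      using Y'[of t] c_id[OF t] by (simp add: Z_def flip: exp_add)
  qed
qed

section \<open>The derivative of the potential\<close>

text \<open>On the line the Frechet derivative in the direction 1 is \<open>deriv\<close>, so two
  levels of the recursion defining smoothness, both in that direction, yield a continuous second
  derivative.\<close>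

lemma smooth_on_UNIV_derivs:
  fixes g :: "real \<Rightarrow> real"
  assumes "smooth_on UNIV g"
  shows "(g has_real_derivative deriv g x) (at x)"
    and "(deriv g has_real_derivative deriv (deriv g) x) (at x)"
    and "continuous_on UNIV (deriv (deriv g))"
proof -
  have frechet: "frechet_derivative f (at x) 1 = deriv f x"
    if "f differentiable_on UNIV" for f :: "real \<Rightarrow> real" and x
  proof -
    have "(f has_real_derivative deriv f x) (at x)"
      using that by (simp add: differentiable_on_def DERIV_deriv_iff_real_differentiable)
    then have "(f has_derivative (*) (deriv f x)) (at x)"
      by (simp add: has_field_derivative_def)
    from frechet_derivative_at[OF this] have "frechet_derivative f (at x) = (*) (deriv f x)" ..
    then show ?thesis by simp
  qed
  have "k_times_differentiable_on (Suc (Suc 0)) UNIV g"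
    using assms unfolding smooth_on_def by blast
  then have g: "g differentiable_on UNIV"
    and dg: "k_times_differentiable_on (Suc 0) UNIV (\<lambda>x. frechet_derivative g (at x) 1)"
    by auto
  from dg have dg: "k_times_differentiable_on (Suc 0) UNIV (deriv g)"
    by (simp only: frechet[OF g])
  then have d: "deriv g differentiable_on UNIV"
    and c: "continuous_on UNIV (\<lambda>x. frechet_derivative (deriv g) (at x) 1)"
    by auto
  show "continuous_on UNIV (deriv (deriv g))"
    using c by (simp only: frechet[OF d])
  show "(g has_real_derivative deriv g x) (at x)"
    using g by (simp add: differentiable_on_def DERIV_deriv_iff_real_differentiable)
  show "(deriv g has_real_derivative deriv (deriv g) x) (at x)"
    using d by (simp add: differentiable_on_def DERIV_deriv_iff_real_differentiable)
qed

text \<open>A concave function lies below its tangents. A negative slope would drag \<open>g\<close>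
  below every bound, so slopes on the tail are nonnegative; comparing the tangents at
  \<open>p\<close> and at \<open>x\<close> shows that the slope cannot be positive beyond the
  critical point \<open>p\<close>.\<close>

lemma concave_tail_deriv_eq_0:
  fixes g :: "real \<Rightarrow> real"
  assumes deriv: "\<And>x. (g has_real_derivative deriv g x) (at x)"
    and bdd: "bounded (range g)" and conc: "concave_on {a..} g"
    and "a < p" "deriv g p = 0" "p \<le> x"
  shows "deriv g x = 0"
proof -
  have tangent: "g y \<le> g c + deriv g c * (y - c)" if "a < c" "a \<le> y" for c y
  proof -
    have "convex_on {a..} (\<lambda>x. - g x)"
      using conc by (simp add: concave_on_def)
    moreover have "((\<lambda>x. - g x) has_real_derivative - deriv g c) (at c within {a..})"
      using deriv by (intro derivative_intros) (rule has_field_derivative_at_within)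
    ultimately have "- g y - (- g c) \<ge> - deriv g c * (y - c)"
      using that by (intro convex_on_imp_above_tangent[where A = "{a..}"])
        (auto simp: interior_real_atLeast)
    then show ?thesis by simp
  qed
  have nonneg: "deriv g c \<ge> 0" if "a < c" for c
  proof (rule ccontr)
    assume neg: "\<not> deriv g c \<ge> 0"
    obtain B where B: "\<And>x. \<bar>g x\<bar> \<le> B"
      using bdd by (auto simp: bounded_iff)
    \<comment> \<open>At this point the tangent has fallen by \<open>2 * B + 1\<close>, more than
      the oscillation \<open>2 * B\<close> that the bound on \<open>g\<close> allows.\<close>
    define y where "y = c + (2 * B + 1) / - deriv g c"
    have "B \<ge> 0" using B[of 0] by simp
    then have "y \<ge> c" using neg by (simp add: y_def field_simps)
    have "g y \<le> g c + deriv g c * (y - c)"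
      using that \<open>y \<ge> c\<close> by (intro tangent) auto
    also have "deriv g c * (y - c) = - (2 * B + 1)"
      using neg by (simp add: y_def field_simps)
    finally show False using B[of y] B[of c] by (auto simp: abs_le_iff)
  qed
  have "g x \<le> g p" using tangent[of p x] assms by simp
  moreover have "g p \<le> g x + deriv g x * (p - x)" using tangent[of x p] assms by simp
  ultimately have *: "deriv g x * (x - p) \<le> 0"
    by (simp add: algebra_simps)
  show ?thesis
  proof (cases "x = p")
    case False
    then have "deriv g x \<le> 0"
      using * assms by (metis diff_gt_0_iff_gt linorder_not_le mult_pos_pos order_le_less)
    then show ?thesis using nonneg[of x] assms by simp
  qed (use assms in simp)
qed

text \<open>Since \<open>g\<close> is even, \<open>deriv g\<close> is odd, and its vanishing on the
  right tail carries over to the left. On the compact interval in between, continuity bounds both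
  derivatives; the mean value inequality then turns the bound on the second derivative into a
  Lipschitz constant.\<close>

lemma deriv_bounded_Lipschitz:
  fixes g :: "real \<Rightarrow> real"
  assumes smooth: "smooth_on UNIV g" and even: "\<And>x. g (- x) = g x"
    and bdd: "bounded (range g)" and conc: "concave_on {a..} g"
    and "a < p" "deriv g p = 0"
  shows "\<exists>L>0. (\<forall>x. \<bar>deriv g x\<bar> \<le> L) \<and> (\<forall>x y. \<bar>deriv g x - deriv g y\<bar> \<le> L * \<bar>x - y\<bar>)"
proof -
  note d = smooth_on_UNIV_derivs[OF smooth]
  define q where "q = max p 0"
  have odd: "deriv g (- x) = - deriv g x" for x
  proof -
    have "((\<lambda>x. g (- x)) has_real_derivative - deriv g (- x)) (at x)"
      using DERIV_chain2[OF d(1) DERIV_minus[OF DERIV_ident], of x] by simp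
    then have "(g has_real_derivative - deriv g (- x)) (at x)"
      by (simp add: even)
    then show ?thesis using DERIV_unique[OF d(1)] by fastforce
  qed
  have zero: "deriv g x = 0" if "\<bar>x\<bar> \<ge> q" for x
    using concave_tail_deriv_eq_0[OF d(1) bdd conc assms(5,6), of x]
      concave_tail_deriv_eq_0[OF d(1) bdd conc assms(5,6), of "- x"] that odd[of x]
    by (auto simp: q_def abs_if split: if_splits)
  \<comment> \<open>The inequality is strict because the second derivative vanishes where
    \<open>deriv g\<close> is zero on a whole neighbourhood.\<close>
  have zero2: "deriv (deriv g) x = 0" if "\<bar>x\<bar> > q" for x
  proof -
    have "\<forall>\<^sub>F y in nhds x. \<bar>y\<bar> > q"
      using that by (intro order_tendstoD(1)[OF tendsto_rabs[OF filterlim_ident]])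
    then have "\<forall>\<^sub>F y in nhds x. deriv g y = 0"
      by eventually_elim (simp add: zero)
    then have "deriv (deriv g) x = deriv (\<lambda>_. 0) x"
      by (intro deriv_cong_ev) auto
    then show ?thesis by simp
  qed
  have "continuous_on {-q..q} (deriv g)"
    using d(2) by (meson DERIV_isCont continuous_at_imp_continuous_on)
  then have "bounded (deriv g ` {-q..q})" and "bounded (deriv (deriv g) ` {-q..q})"
    using continuous_on_subset[OF d(3)] by (auto intro!: compact_imp_bounded compact_continuous_image)
  then obtain B1 B2 where B: "\<And>x. x \<in> {-q..q} \<Longrightarrow> \<bar>deriv g x\<bar> \<le> B1"
      "\<And>x. x \<in> {-q..q} \<Longrightarrow> \<bar>deriv (deriv g) x\<bar> \<le> B2"
    unfolding bounded_iff by fastforce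
  have "q \<ge> 0" by (simp add: q_def)
  with B[of 0] have "B1 \<ge> 0" "B2 \<ge> 0" by (force simp: abs_le_iff)+
  show ?thesis
  \<comment> \<open>One constant serves as bound and as Lipschitz constant; the summand 1 keeps it
    positive even if both bounds are 0.\<close>
  proof (intro exI[of _ "B1 + B2 + 1"] conjI allI)
    show "B1 + B2 + 1 > 0" using \<open>B1 \<ge> 0\<close> \<open>B2 \<ge> 0\<close> by simp
    have "\<bar>deriv g x\<bar> \<le> B1 + B2 + 1 \<and> \<bar>deriv (deriv g) x\<bar> \<le> B1 + B2 + 1" for x
    proof (cases "x \<in> {-q..q}")
      case True
      from B[OF this] show ?thesis using \<open>B1 \<ge> 0\<close> \<open>B2 \<ge> 0\<close> by linarith
    next
      case False
      then have "\<bar>x\<bar> > q" by auto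
      from zero[OF less_imp_le[OF this]] zero2[OF this] show ?thesis
        using \<open>B1 \<ge> 0\<close> \<open>B2 \<ge> 0\<close> by simp
    qed
    then have b: "\<bar>deriv g x\<bar> \<le> B1 + B2 + 1" "\<bar>deriv (deriv g) x\<bar> \<le> B1 + B2 + 1" for x
      by blast+
    show "\<bar>deriv g x\<bar> \<le> B1 + B2 + 1" for x
      by (rule b)
    show "\<bar>deriv g x - deriv g y\<bar> \<le> (B1 + B2 + 1) * \<bar>x - y\<bar>" for x y
      using field_differentiable_bound[OF convex_UNIV d(2), of "B1 + B2 + 1" x y] b(2)
      by simp
  qed
qed

section \<open>A Schur test for the bond kernel\<close>

text \<open>At \<open>z = 0\<close> division by zero gives the value 0, so the kernel is finite
  everywhere.\<close>

definition bond_kernel :: "real \<Rightarrow> real^2 \<Rightarrow> real" where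
  "bond_kernel \<epsilon> z = (if norm z < \<epsilon> then 1 / norm z else 0)"

lemma bond_kernel_nonneg: "bond_kernel \<epsilon> z \<ge> 0"
  by (simp add: bond_kernel_def)

lemma bond_kernel_commute: "bond_kernel \<epsilon> (x - y) = bond_kernel \<epsilon> (y - x)"
  by (simp add: bond_kernel_def norm_minus_commute)

lemma borel_measurable_bond_kernel [measurable]: "bond_kernel \<epsilon> \<in> borel_measurable borel"
  unfolding bond_kernel_def by measurable

text \<open>On the dyadic annulus \<open>\<epsilon> / 2 ^ Suc n \<le> norm z < \<epsilon> / 2 ^ n\<close> the kernel is at most
  \<open>2 ^ Suc n / \<epsilon>\<close>, while the area is of order \<open>(\<epsilon> / 2 ^ n)\<^sup>2\<close>.\<close>

lemma nn_integral_bond_kernel_finite: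
  assumes "\<epsilon> > 0"
  shows "(\<integral>\<^sup>+z. ennreal (bond_kernel \<epsilon> z) \<partial>lborel) < \<infinity>"
proof -
  define w where "w = measure lborel (ball (0::real^2) 1)"
  define c where "c n = 2 ^ Suc n / \<epsilon>" for n
  \<comment> \<open>Full balls replace the annuli: the term belonging to the annulus of
    \<open>z\<close> already dominates the kernel, and the other terms are nonnegative.\<close>
  have pw: "ennreal (bond_kernel \<epsilon> z) \<le> (\<Sum>n. ennreal (c n) * indicator (ball 0 (\<epsilon> / 2^n)) z)"
    for z :: "real^2"
  proof (cases "z = 0 \<or> norm z \<ge> \<epsilon>")
    case True
    then show ?thesis by (auto simp: bond_kernel_def)
  next
    case False
    then have z: "norm z > 0" "norm z < \<epsilon>" by auto
    define P where "P n \<longleftrightarrow> \<epsilon> / 2 ^ Suc n \<le> norm z" for n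
    obtain m where "(1/2) ^ m < norm z / \<epsilon>"
      using real_arch_pow_inv[of "norm z / \<epsilon>" "1/2"] z assms by auto
    then have "\<epsilon> < norm z * 2 ^ m"
      using assms by (simp add: field_simps power_one_over)
    also have "\<dots> \<le> norm z * 2 ^ Suc m"
      by (intro mult_left_mono) simp_all
    finally have "P m"
      by (simp add: P_def field_simps)
    then have "P (Least P)" by (rule LeastI)
    \<comment> \<open>Minimality yields the upper bound on \<open>norm z\<close>; for
      \<open>n = 0\<close> it is the assumption \<open>norm z < \<epsilon>\<close>.\<close>
    define n where "n = Least P"
    have lower: "\<epsilon> / 2 ^ Suc n \<le> norm z" using \<open>P (Least P)\<close> by (simp add: P_def n_def)
    have upper: "norm z < \<epsilon> / 2 ^ n"
    proof (cases n)
      case (Suc k)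
      then have "\<not> P k" using not_less_Least[of k P] by (simp add: n_def)
      then show ?thesis by (simp add: P_def Suc)
    qed (use z in simp)
    have "bond_kernel \<epsilon> z \<le> c n"
      using lower z assms by (simp add: bond_kernel_def c_def field_simps)
    then have "ennreal (bond_kernel \<epsilon> z) \<le> ennreal (c n) * indicator (ball 0 (\<epsilon> / 2^n)) z"
      using upper by (simp add: ennreal_leI)
    also have "\<dots> \<le> (\<Sum>n. ennreal (c n) * indicator (ball 0 (\<epsilon> / 2^n)) z)"
    proof -
      have "h n \<le> (\<Sum>n. h n)" for h :: "nat \<Rightarrow> ennreal"
        using sum_le_suminf[of h "{n}"] by simp
      then show ?thesis .
    qed
    finally show ?thesis .
  qed
  have area: "emeasure lborel (ball (0::real^2) (\<epsilon> / 2^n)) = ennreal ((\<epsilon> / 2^n)\<^sup>2 * w)" for n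
  proof -
    have "emeasure lborel (ball (0::real^2) r) = ennreal (measure lborel (ball (0::real^2) r))" for r
      using emeasure_lborel_ball_finite[of "0::real^2" r] by (simp add: emeasure_eq_ennreal_measure)
    then show ?thesis
      using content_ball_conv_unit_ball[of "\<epsilon> / 2^n" "0::real^2"] assms by (simp add: w_def)
  qed
  \<comment> \<open>The area has two factors \<open>1 / 2^n\<close> and the kernel costs only one,
    so a geometric series remains: a singularity of order one is integrable in dimension
    two.\<close>
  have term_eq: "ennreal (c n) * ennreal ((\<epsilon> / 2^n)\<^sup>2 * w) = ennreal (2 * \<epsilon> * w * (1/2)^n)" for n
  proof -
    have "c n * ((\<epsilon> / 2^n)\<^sup>2 * w) = 2 * \<epsilon> * w * (1/2)^n"
      using assms by (simp add: c_def power2_eq_square power_one_over field_simps)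
    then show ?thesis
      using assms by (simp add: c_def ennreal_mult'[symmetric])
  qed
  have "(\<integral>\<^sup>+z. ennreal (bond_kernel \<epsilon> z) \<partial>lborel)
      \<le> (\<integral>\<^sup>+z. (\<Sum>n. ennreal (c n) * indicator (ball 0 (\<epsilon> / 2^n)) z) \<partial>(lborel :: (real^2) measure))"
    by (intro nn_integral_mono pw)
  also have "\<dots> = (\<Sum>n. \<integral>\<^sup>+z. ennreal (c n) * indicator (ball (0::real^2) (\<epsilon> / 2^n)) z \<partial>lborel)"
    by (intro nn_integral_suminf borel_measurable_times_ennreal borel_measurable_const
        borel_measurable_indicator) simp
  also have "\<dots> = (\<Sum>n. ennreal (c n) * emeasure lborel (ball (0::real^2) (\<epsilon> / 2^n)))"
    by (intro suminf_cong nn_integral_cmult_indicator) simp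
  also have "\<dots> = (\<Sum>n. ennreal (2 * \<epsilon> * w * (1/2)^n))"
    by (simp add: area term_eq)
  also have "\<dots> = ennreal (\<Sum>n. 2 * \<epsilon> * w * (1/2)^n)"
    using assms by (intro suminf_ennreal2 summable_mult summable_geometric) (auto simp: w_def)
  also have "\<dots> < \<infinity>" by simp
  finally show ?thesis .
qed

text \<open>Translation invariance makes the bound uniform in the centre \<open>x\<close>, and
  restriction to \<open>S\<close> only lowers the integral.\<close>

lemma nn_integral_bond_kernel_bound:
  assumes "\<epsilon> > 0"
  obtains K where "K \<ge> 0"
    "\<And>x S. S \<in> sets lebesgue \<Longrightarrow>
      (\<integral>\<^sup>+y. ennreal (bond_kernel \<epsilon> (y - x)) \<partial>lebesgue_on S) \<le> ennreal K"
proof -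
  define I where "I = (\<integral>\<^sup>+z. ennreal (bond_kernel \<epsilon> z) \<partial>lborel)"
  have "I < \<infinity>" using nn_integral_bond_kernel_finite[OF assms] by (simp add: I_def)
  have "(\<integral>\<^sup>+y. ennreal (bond_kernel \<epsilon> (y - x)) \<partial>lebesgue_on S) \<le> I"
    if "S \<in> sets lebesgue" for x S
  proof -
    have "(\<integral>\<^sup>+y. ennreal (bond_kernel \<epsilon> (y - x)) \<partial>lebesgue_on S)
        = (\<integral>\<^sup>+y. ennreal (bond_kernel \<epsilon> (y - x)) * indicator S y \<partial>lebesgue)"
      using that by (simp add: nn_integral_restrict_space)
    also have "\<dots> \<le> (\<integral>\<^sup>+y. ennreal (bond_kernel \<epsilon> (y - x)) \<partial>lebesgue)"
      by (intro nn_integral_mono) (simp add: indicator_def)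
    also have "\<dots> = (\<integral>\<^sup>+y. ennreal (bond_kernel \<epsilon> (y - x)) \<partial>lborel)"
      by (simp add: nn_integral_completion)
    also have "\<dots> = (\<integral>\<^sup>+y. ennreal (bond_kernel \<epsilon> (y - x)) \<partial>distr lborel borel ((+) x))"
      by (simp only: lborel_distr_plus)
    also have "\<dots> = I"
      by (subst nn_integral_distr) (simp_all add: I_def)
    finally show ?thesis .
  qed
  moreover have "I = ennreal (enn2real I)" using \<open>I < \<infinity>\<close> by simp
  ultimately show thesis
    by (metis that enn2real_nonneg)
qed

text \<open>Write \<open>k = sqrt k * sqrt k\<close> and apply the Cauchy-Schwarz inequality in
  \<open>y\<close>; one factor is at most \<open>K\<close>. In the other,
  \<open>(f x + f y)\<^sup>2\<close> is at most twice the sum of the squares, and by Tonelli and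
  symmetry of \<open>k\<close> both halves contribute at most \<open>2 * K\<close> times the
  integral of \<open>f\<^sup>2\<close>. Hence
  \<open>4 * K\<^sup>2 = K * (2 * K + 2 * K)\<close>.\<close>

lemma Schur_test:
  fixes k :: "'a \<Rightarrow> 'a \<Rightarrow> real" and f :: "'a \<Rightarrow> real"
  assumes "sigma_finite_measure M"
    and k [measurable]: "case_prod k \<in> borel_measurable (M \<Otimes>\<^sub>M M)"
    and f [measurable]: "f \<in> borel_measurable M"
    and nonneg: "\<And>x y. k x y \<ge> 0" "\<And>x. f x \<ge> 0"
    and sym: "\<And>x y. k x y = k y x"
    and bound: "\<And>x. (\<integral>\<^sup>+y. ennreal (k x y) \<partial>M) \<le> ennreal K" and "K \<ge> 0"
  shows "(\<integral>\<^sup>+x. (\<integral>\<^sup>+y. ennreal (k x y * (f x + f y)) \<partial>M)\<^sup>2 \<partial>M)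
    \<le> ennreal (4 * K\<^sup>2) * (\<integral>\<^sup>+x. ennreal ((f x)\<^sup>2) \<partial>M)"
proof -
  interpret pair_sigma_finite M M
    using assms(1) by (simp add: pair_sigma_finite_def)
  let ?I = "\<integral>\<^sup>+x. ennreal ((f x)\<^sup>2) \<partial>M"
  have CS: "(\<integral>\<^sup>+y. ennreal (k x y * (f x + f y)) \<partial>M)\<^sup>2
      \<le> ennreal K * ((\<integral>\<^sup>+y. ennreal (2 * k x y * (f x)\<^sup>2) \<partial>M) + (\<integral>\<^sup>+y. ennreal (2 * k x y * (f y)\<^sup>2) \<partial>M))"
    if [measurable]: "x \<in> space M" for x
  proof -
    have [measurable]: "k x \<in> borel_measurable M"
      using measurable_Pair2[OF k that] by simp
    have "(\<integral>\<^sup>+y. ennreal (k x y * (f x + f y)) \<partial>M)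
        = (\<integral>\<^sup>+y. ennreal (sqrt (k x y)) * ennreal (sqrt (k x y) * (f x + f y)) \<partial>M)"
      using nonneg by (intro nn_integral_cong) (simp flip: ennreal_mult add: mult.assoc[symmetric])
    also have "\<dots>\<^sup>2 \<le> (\<integral>\<^sup>+y. (ennreal (sqrt (k x y)))\<^sup>2 \<partial>M)
        * (\<integral>\<^sup>+y. (ennreal (sqrt (k x y) * (f x + f y)))\<^sup>2 \<partial>M)"
      by (rule Cauchy_Schwarz_nn_integral) measurable
    also have "(\<integral>\<^sup>+y. (ennreal (sqrt (k x y)))\<^sup>2 \<partial>M) = (\<integral>\<^sup>+y. ennreal (k x y) \<partial>M)"
      using nonneg by (intro nn_integral_cong) (simp add: ennreal_power)
    also have "(\<integral>\<^sup>+y. (ennreal (sqrt (k x y) * (f x + f y)))\<^sup>2 \<partial>M)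
        \<le> (\<integral>\<^sup>+y. ennreal (2 * k x y * (f x)\<^sup>2) + ennreal (2 * k x y * (f y)\<^sup>2) \<partial>M)"
    proof (rule nn_integral_mono)
      fix y
      have "(f x + f y)\<^sup>2 \<le> 2 * (f x)\<^sup>2 + 2 * (f y)\<^sup>2"
        using sum_squares_bound[of "f x" "f y"] by (simp add: power2_sum)
      from mult_left_mono[OF this nonneg(1)[of x y]]
      have "(sqrt (k x y) * (f x + f y))\<^sup>2 \<le> 2 * k x y * (f x)\<^sup>2 + 2 * k x y * (f y)\<^sup>2"
        using nonneg unfolding power_mult_distrib by (simp add: algebra_simps)
      then show "(ennreal (sqrt (k x y) * (f x + f y)))\<^sup>2
          \<le> ennreal (2 * k x y * (f x)\<^sup>2) + ennreal (2 * k x y * (f y)\<^sup>2)"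
        using nonneg by (simp add: ennreal_power ennreal_leI flip: ennreal_plus)
    qed
    also have "\<dots> = (\<integral>\<^sup>+y. ennreal (2 * k x y * (f x)\<^sup>2) \<partial>M) + (\<integral>\<^sup>+y. ennreal (2 * k x y * (f y)\<^sup>2) \<partial>M)"
      by (rule nn_integral_add) measurable
    finally show ?thesis
      using bound[of x] by (meson mult_left_mono mult_right_mono order_trans zero_le)
  qed
  have half: "(\<integral>\<^sup>+x. (\<integral>\<^sup>+y. ennreal (2 * k x y * (f x)\<^sup>2) \<partial>M) \<partial>M) \<le> ennreal (2 * K) * ?I"
  proof -
    have "(\<integral>\<^sup>+y. ennreal (2 * k x y * (f x)\<^sup>2) \<partial>M) \<le> ennreal (2 * K) * ennreal ((f x)\<^sup>2)"
      if "x \<in> space M" for x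
    proof -
      have [measurable]: "k x \<in> borel_measurable M"
        using measurable_Pair2[OF k that] by simp
      have "(\<integral>\<^sup>+y. ennreal (2 * k x y * (f x)\<^sup>2) \<partial>M) = (\<integral>\<^sup>+y. ennreal (2 * (f x)\<^sup>2) * ennreal (k x y) \<partial>M)"
        using nonneg by (intro nn_integral_cong) (simp flip: ennreal_mult add: mult_ac)
      also have "\<dots> = ennreal (2 * (f x)\<^sup>2) * (\<integral>\<^sup>+y. ennreal (k x y) \<partial>M)"
        by (rule nn_integral_cmult) measurable
      also have "\<dots> \<le> ennreal (2 * (f x)\<^sup>2) * ennreal K"
        by (intro mult_left_mono bound) simp
      also have "\<dots> = ennreal (2 * K) * ennreal ((f x)\<^sup>2)"
        using \<open>K \<ge> 0\<close> by (simp flip: ennreal_mult add: mult_ac)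
      finally show ?thesis .
    qed
    then have "(\<integral>\<^sup>+x. (\<integral>\<^sup>+y. ennreal (2 * k x y * (f x)\<^sup>2) \<partial>M) \<partial>M)
        \<le> (\<integral>\<^sup>+x. ennreal (2 * K) * ennreal ((f x)\<^sup>2) \<partial>M)"
      by (intro nn_integral_mono)
    also have "\<dots> = ennreal (2 * K) * ?I"
      by (rule nn_integral_cmult) measurable
    finally show ?thesis .
  qed
  have swap: "(\<integral>\<^sup>+x. (\<integral>\<^sup>+y. ennreal (2 * k x y * (f y)\<^sup>2) \<partial>M) \<partial>M)
      = (\<integral>\<^sup>+x. (\<integral>\<^sup>+y. ennreal (2 * k x y * (f x)\<^sup>2) \<partial>M) \<partial>M)"
    by (subst Fubini') (simp_all add: sym)
  have "(\<integral>\<^sup>+x. (\<integral>\<^sup>+y. ennreal (k x y * (f x + f y)) \<partial>M)\<^sup>2 \<partial>M)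
      \<le> (\<integral>\<^sup>+x. ennreal K * ((\<integral>\<^sup>+y. ennreal (2 * k x y * (f x)\<^sup>2) \<partial>M)
          + (\<integral>\<^sup>+y. ennreal (2 * k x y * (f y)\<^sup>2) \<partial>M)) \<partial>M)"
    by (intro nn_integral_mono CS)
  also have "\<dots> = ennreal K * ((\<integral>\<^sup>+x. (\<integral>\<^sup>+y. ennreal (2 * k x y * (f x)\<^sup>2) \<partial>M) \<partial>M)
      + (\<integral>\<^sup>+x. (\<integral>\<^sup>+y. ennreal (2 * k x y * (f y)\<^sup>2) \<partial>M) \<partial>M))"
    by (subst nn_integral_cmult, measurable) (subst nn_integral_add, measurable)
  also have "\<dots> \<le> ennreal K * (ennreal (2 * K) * ?I + ennreal (2 * K) * ?I)"
    unfolding swap by (intro mult_left_mono add_mono half) simp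
  also have "\<dots> = ennreal (4 * K\<^sup>2) * ?I"
  proof -
    have "ennreal (4 * K\<^sup>2) = ennreal K * (ennreal (2 * K) + ennreal (2 * K))"
      using \<open>K \<ge> 0\<close> by (simp add: power2_eq_square flip: ennreal_mult ennreal_plus)
    then show ?thesis by (simp add: distrib_right mult.assoc)
  qed
  finally show ?thesis .
qed

section \<open>The nonlocal force\<close>

lemma L2_norm_nonneg: "L2_norm D f \<ge> 0"
  unfolding L2_norm_def by (intro real_sqrt_ge_zero Bochner_Integration.integral_nonneg) simp

lemma rigid_motion_axis:
  "rigid_motion \<Omega> c x = (- \<Omega> * x$2) *\<^sub>R axis 1 1 + (\<Omega> * x$1) *\<^sub>R axis 2 1 + c"
  by (simp add: rigid_motion_def vec_eq_iff forall_2 axis_def)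

lemma continuous_rigid_motion: "continuous_on S (rigid_motion \<Omega> c)"
  unfolding rigid_motion_axis[abs_def] by (intro continuous_intros)

lemma norm_rigid_motion_le: "norm (rigid_motion \<Omega> c x) \<le> 2 * \<bar>\<Omega>\<bar> * norm x + norm c"
proof -
  have "norm (rigid_motion \<Omega> c x)
      \<le> norm ((- \<Omega> * x$2) *\<^sub>R (axis 1 1 :: real^2)) + norm ((\<Omega> * x$1) *\<^sub>R (axis 2 1 :: real^2)) + norm c"
    unfolding rigid_motion_axis by (intro norm_triangle_le add_mono norm_triangle_ineq order_refl)
  also have "\<dots> = \<bar>\<Omega>\<bar> * \<bar>x$2\<bar> + \<bar>\<Omega>\<bar> * \<bar>x$1\<bar> + norm c"
    by (simp add: abs_mult norm_axis_1)
  also have "\<dots> \<le> \<bar>\<Omega>\<bar> * norm x + \<bar>\<Omega>\<bar> * norm x + norm c"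
    by (intro add_mono mult_left_mono component_le_norm_cart) auto
  finally show ?thesis by simp
qed

text \<open>Translations cancel in the difference, and the rotational part is perpendicular to
  \<open>y - x\<close>.\<close>

lemma rigid_motion_no_strain: "(y - x) \<bullet> (rigid_motion \<Omega> c x - rigid_motion \<Omega> c y) = 0"
  by (simp add: rigid_motion_def inner_vec_def sum_2 algebra_simps)

text \<open>A bond crosses if some parameter in \<open>{0..1}\<close> puts a point of the segment on
  the closed frontier, and the projection of a closed set along a compact factor is closed. This is
  what makes the cutoff jointly measurable in both endpoints.\<close>

lemma closed_crosses_boundary: "closed {p. crosses_boundary D (snd p) (fst p)}"
proof -
  let ?T = "{q :: real \<times> (real^2) \<times> (real^2).
    (1 - fst q) *\<^sub>R fst (snd q) + fst q *\<^sub>R snd (snd q) \<in> frontier D}"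
  have "closed ?T"
    using continuous_closed_vimage[OF frontier_closed, of
        "\<lambda>q :: real \<times> (real^2) \<times> (real^2). (1 - fst q) *\<^sub>R fst (snd q) + fst q *\<^sub>R snd (snd q)" D]
    by (simp add: vimage_def continuous_intros)
  then have "closed {p. \<exists>t. t \<in> {0..1} \<and> (t, p) \<in> ?T}"
    by (intro closed_compact_projection) auto
  also have "{p. \<exists>t. t \<in> {0..1} \<and> (t, p) \<in> ?T} = {p. crosses_boundary D (snd p) (fst p)}"
    by (auto simp: crosses_boundary_def closed_segment_def)
  finally show ?thesis .
qed

lemma crosses_boundary_commute: "crosses_boundary D y x = crosses_boundary D x y"
  by (simp add: crosses_boundary_def closed_segment_commute)

lemma unit_dir_commute: "unit_dir x y = - unit_dir y x"
  unfolding unit_dir_def norm_minus_commute[of x y] by (simp flip: scaleR_minus_right)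

lemma norm_unit_dir_le: "norm (unit_dir y x) \<le> 1"
  by (cases "y = x") (simp_all add: unit_dir_def)

lemma strain_commute: "strain D y x u = strain D x y u"
proof -
  have "u x - u y = - (u y - u x)" by simp
  then show ?thesis
    unfolding strain_def crosses_boundary_commute[of D y x] unit_dir_commute[of x y]
      norm_minus_commute[of x y] by (simp only: scaleR_minus_right inner_minus_left inner_minus_right minus_minus)
qed

text \<open>The shape of the potential is condensed into a bounded, Lipschitz
  \<open>deriv g\<close>, and the geometry into a bounded Borel set; every estimate on the force
  rests on these facts alone.\<close>

locale bond_model =
  fixes D :: "(real^2) set" and J g :: "real \<Rightarrow> real" and \<epsilon> M L :: real
  assumes D_borel: "D \<in> sets borel" and D_bounded: "bounded D"
    and eps: "\<epsilon> > 0" and J_meas: "J \<in> borel_measurable borel"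
    and J_zero: "\<And>r. r \<ge> 1 \<Longrightarrow> J r = 0"
    and J_bounds: "\<And>r. 0 \<le> r \<Longrightarrow> r < 1 \<Longrightarrow> 0 \<le> J r \<and> J r \<le> M"
    and g_deriv: "\<And>x. (g has_real_derivative deriv g x) (at x)"
    and L_pos: "L > 0" and dg_bound: "\<And>x. \<bar>deriv g x\<bar> \<le> L"
    and dg_Lipschitz: "\<And>x y. \<bar>deriv g x - deriv g y\<bar> \<le> L * \<bar>x - y\<bar>"
begin

lemma D_lebesgue: "D \<in> sets lebesgue"
  using D_borel by simp

lemma D_lmeasurable: "D \<in> lmeasurable"
  using D_bounded D_lebesgue by (rule bounded_set_imp_lmeasurable)

sublocale finite_measure "lebesgue_on D"
  using D_lmeasurable by (rule finite_measure_lebesgue_on)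

sublocale pair: pair_sigma_finite "lebesgue_on D" "lebesgue_on D" ..

lemma deriv_g_measurable [measurable]: "deriv g \<in> borel_measurable borel"
proof (rule borel_measurable_continuous_onI)
  have "L-lipschitz_on UNIV (deriv g)"
    using dg_Lipschitz L_pos by (intro lipschitz_onI) (auto simp: dist_real_def)
  then show "continuous_on UNIV (deriv g)"
    by (rule lipschitz_on_continuous_on)
qed

section \<open>Pointwise estimates of the force density\<close>

definition density :: "(real^2 \<Rightarrow> real^2) \<Rightarrow> real^2 \<Rightarrow> real^2 \<Rightarrow> real^2" where
  "density u x y = (2 * deriv (energy D J g \<epsilon> y x) (strain D y x u)) *\<^sub>R unit_dir y x"

definition coupling :: "real \<Rightarrow> real" where
  "coupling r = 2 * J (r / \<epsilon>) / (\<epsilon>^3 * measure lebesgue (ball (0::real^2) 1))"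

definition coupling_max :: real where
  "coupling_max = 2 * M / (\<epsilon>^3 * measure lebesgue (ball (0::real^2) 1))"

lemma coupling_bounds:
  assumes "r \<ge> 0"
  shows "0 \<le> coupling r" "coupling r \<le> coupling_max" "r \<ge> \<epsilon> \<Longrightarrow> coupling r = 0"
proof -
  have M: "M \<ge> 0" using J_bounds[of 0] by simp
  show z: "coupling r = 0" if "r \<ge> \<epsilon>"
    using J_zero[of "r / \<epsilon>"] that eps by (simp add: coupling_def)
  show "0 \<le> coupling r" "coupling r \<le> coupling_max"
    using J_bounds[of "r / \<epsilon>"] J_zero[of "r / \<epsilon>"] M assms eps
    by (cases "r / \<epsilon> < 1"; simp add: coupling_def coupling_max_def divide_right_mono)+
qed

lemma coupling_max_nonneg: "coupling_max \<ge> 0"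
  using coupling_bounds[of 0] by simp

text \<open>The chain rule in the strain variable produces the second root
  \<open>sqrt (norm (y - x))\<close>. For a crossing pair the energy vanishes identically in the
  strain, hence so does its derivative.\<close>

lemma density_eq:
  "density u x y = (if crosses_boundary D y x then 0 else
     (coupling (norm (y - x)) / norm (y - x) * sqrt (norm (y - x))
       * deriv g (sqrt (norm (y - x)) * strain D y x u)) *\<^sub>R unit_dir y x)"
proof (cases "crosses_boundary D y x")
  case True
  then have "energy D J g \<epsilon> y x = (\<lambda>S. 0)" by (simp add: energy_def fun_eq_iff)
  then show ?thesis using True by (simp add: density_def)
next
  case False
  define c where "c = J (norm (y - x) / \<epsilon>)
    / (\<epsilon>^3 * measure lebesgue (ball (0::real^2) 1) * norm (y - x))"
  define s where "s = sqrt (norm (y - x))"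
  have "energy D J g \<epsilon> y x = (\<lambda>S. c * g (s * S))"
    using False by (simp add: energy_def fun_eq_iff c_def s_def)
  moreover have "((\<lambda>S. c * g (s * S)) has_real_derivative c * (deriv g (s * S) * s)) (at S)" for S
    by (intro DERIV_cmult DERIV_chain2[OF g_deriv]) (auto intro!: derivative_eq_intros)
  ultimately have "deriv (energy D J g \<epsilon> y x) S = c * (deriv g (s * S) * s)" for S
    by (simp add: DERIV_imp_deriv)
  then show ?thesis
    using False by (simp add: density_def coupling_def c_def s_def mult_ac)
qed

text \<open>Newton's third law for a bond: the strain is symmetric in the endpoints and the
  direction is odd.\<close>

lemma density_antisym: "density u y x = - density u x y"
  unfolding density_eq crosses_boundary_commute[of D x y] strain_commute[of D x y]
    unit_dir_commute[of x y] norm_minus_commute[of x y] by simp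

text \<open>Because \<open>deriv g\<close> is bounded, the bound does not involve \<open>u\<close>;
  it makes the force of every measurable field a bounded function on \<open>D\<close>.\<close>

lemma density_le:
  "norm (density u x y) \<le> coupling_max * sqrt \<epsilon> * L * bond_kernel \<epsilon> (y - x)"
proof -
  define r where "r = norm (y - x)"
  have r: "r \<ge> 0" by (simp add: r_def)
  note c = coupling_bounds[OF r]
  let ?A = "deriv g (sqrt r * strain D y x u)"
  have "norm (density u x y) \<le> \<bar>coupling r / r * sqrt r * ?A\<bar> * norm (unit_dir y x)"
    using r c by (simp add: density_eq r_def)
  also have "\<dots> \<le> \<bar>coupling r / r * sqrt r * ?A\<bar>"
    using mult_left_mono[OF norm_unit_dir_le, of "\<bar>coupling r / r * sqrt r * ?A\<bar>" y x] by simp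
  also have "\<dots> = coupling r / r * sqrt r * \<bar>?A\<bar>"
    using r c by (simp add: abs_mult)
  also have "\<dots> \<le> coupling_max * sqrt \<epsilon> * L * bond_kernel \<epsilon> (y - x)"
  proof (cases "r < \<epsilon>")
    case True
    have "coupling r / r * sqrt r * \<bar>?A\<bar> \<le> coupling_max / r * sqrt \<epsilon> * L"
      using True r c L_pos dg_bound coupling_max_nonneg eps
      by (intro mult_mono divide_right_mono) (auto intro: divide_nonneg_nonneg)
    then show ?thesis using True by (simp add: bond_kernel_def r_def mult_ac)
  qed (use c in \<open>simp add: bond_kernel_def r_def\<close>)
  finally show ?thesis .
qed

text \<open>With \<open>r = norm (y - x)\<close> and \<open>E\<close> the sum of the two field
  differences, strains differ by at most \<open>E / r\<close>, and
  \<open>sqrt r * (L * (sqrt r * (E / r))) = L * E\<close>. Only the prefactor \<open>1 / r\<close>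
  survives, and it becomes the kernel.\<close>

lemma density_diff_le:
  "norm (density u x y - density v x y)
    \<le> coupling_max * L * (bond_kernel \<epsilon> (y - x) * (norm (u x - v x) + norm (u y - v y)))"
proof (cases "crosses_boundary D y x \<or> y = x")
  case True
  then show ?thesis
    using coupling_max_nonneg L_pos bond_kernel_nonneg by (auto simp: density_eq unit_dir_def)
next
  case False
  define r where "r = norm (y - x)"
  have r: "r > 0" using False by (simp add: r_def)
  then have r0: "r \<ge> 0" by simp
  note c = coupling_bounds[OF r0]
  define E where "E = norm (u x - v x) + norm (u y - v y)"
  have "E \<ge> 0" by (simp add: E_def)
  let ?A = "\<lambda>u. deriv g (sqrt r * strain D y x u)"
  have "strain D y x u - strain D y x v = (((u y - v y) - (u x - v x)) /\<^sub>R r) \<bullet> unit_dir y x"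
    using False by (simp add: strain_def r_def algebra_simps)
  then have "\<bar>strain D y x u - strain D y x v\<bar> \<le> norm (((u y - v y) - (u x - v x)) /\<^sub>R r) * norm (unit_dir y x)"
    by (simp only: Cauchy_Schwarz_ineq2)
  also have "\<dots> \<le> norm (((u y - v y) - (u x - v x)) /\<^sub>R r) * 1"
    by (intro mult_left_mono norm_unit_dir_le) simp
  also have "\<dots> \<le> E / r"
    using norm_triangle_ineq4[of "u y - v y" "u x - v x"] r
    by (simp add: E_def divide_simps)
  finally have strain: "\<bar>strain D y x u - strain D y x v\<bar> \<le> E / r" .
  have "\<bar>?A u - ?A v\<bar> \<le> L * \<bar>sqrt r * strain D y x u - sqrt r * strain D y x v\<bar>"
    by (rule dg_Lipschitz)
  also have "\<dots> = L * (sqrt r * \<bar>strain D y x u - strain D y x v\<bar>)"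
    using r by (simp add: abs_mult flip: right_diff_distrib)
  also have "\<dots> \<le> L * (sqrt r * (E / r))"
    using r L_pos strain by (intro mult_left_mono) auto
  finally have A: "\<bar>?A u - ?A v\<bar> \<le> L * (sqrt r * (E / r))" .
  have "density u x y - density v x y = (coupling r / r * sqrt r * (?A u - ?A v)) *\<^sub>R unit_dir y x"
    using False by (simp add: density_eq r_def algebra_simps)
  then have "norm (density u x y - density v x y)
      = coupling r / r * sqrt r * \<bar>?A u - ?A v\<bar> * norm (unit_dir y x)"
    using r c by (simp add: abs_mult)
  also have "\<dots> \<le> coupling r / r * sqrt r * (L * (sqrt r * (E / r))) * 1"
    using r c by (intro mult_mono A norm_unit_dir_le) (use \<open>E \<ge> 0\<close> L_pos in auto)
  also have "\<dots> = coupling r * L * E / r"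
    using r by (simp add: field_simps flip: power2_eq_square)
  also have "\<dots> \<le> coupling_max * L * (bond_kernel \<epsilon> (y - x) * E)"
  proof (cases "r < \<epsilon>")
    case True
    have "coupling r * L * E / r \<le> coupling_max * L * E / r"
      using r c L_pos \<open>E \<ge> 0\<close> by (intro divide_right_mono mult_right_mono) auto
    then show ?thesis using True by (simp add: bond_kernel_def r_def)
  qed (use c in \<open>simp add: bond_kernel_def r_def\<close>)
  finally show ?thesis by (simp add: E_def)
qed

section \<open>Measurability and integrals of the force density\<close>

lemma lebesgue_on_id_measurable: "(\<lambda>x. x) \<in> borel_measurable (lebesgue_on D)"
  by (intro continuous_imp_measurable_on_sets_lebesgue continuous_on_id D_lebesgue)

lemma fst_snd_measurable [measurable]:
  "fst \<in> borel_measurable (lebesgue_on D \<Otimes>\<^sub>M lebesgue_on D)"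
  "snd \<in> borel_measurable (lebesgue_on D \<Otimes>\<^sub>M lebesgue_on D)"
  by (rule measurable_compose[OF measurable_fst lebesgue_on_id_measurable]
      measurable_compose[OF measurable_snd lebesgue_on_id_measurable])+

lemma density_measurable [measurable]:
  assumes [measurable]: "u \<in> borel_measurable (lebesgue_on D)"
  shows "case_prod (density u) \<in> borel_measurable (lebesgue_on D \<Otimes>\<^sub>M lebesgue_on D)"
proof -
  let ?N = "lebesgue_on D \<Otimes>\<^sub>M lebesgue_on D"
  note [measurable] = J_meas
  have uf [measurable]: "(\<lambda>p. u (fst p)) \<in> borel_measurable ?N"
    and us [measurable]: "(\<lambda>p. u (snd p)) \<in> borel_measurable ?N"
    by (rule measurable_compose[OF measurable_fst assms] measurable_compose[OF measurable_snd assms])+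
  \<comment> \<open>The identity is measurable from the product of the restricted Lebesgue spaces to
    the Borel sets of the product space, so the closed set of crossing pairs is measurable in the
    former.\<close>
  have "(\<lambda>p. (fst p, snd p)) \<in> borel_measurable ?N"
    by (rule borel_measurable_Pair[OF fst_snd_measurable])
  then have "(\<lambda>p. p) -` {p. crosses_boundary D (snd p) (fst p)} \<inter> space ?N \<in> sets ?N"
    using closed_crosses_boundary by (intro measurable_sets[where A = borel]) auto
  also have "(\<lambda>p. p) -` {p. crosses_boundary D (snd p) (fst p)} \<inter> space ?N
      = {p \<in> space ?N. crosses_boundary D (snd p) (fst p)}" by auto
  finally have [measurable]: "Measurable.pred ?N (\<lambda>p. crosses_boundary D (snd p) (fst p))"
    by (simp add: pred_def)
  show ?thesis
    unfolding case_prod_beta' density_eq strain_def unit_dir_def coupling_def by measurable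
qed

lemma density_measurable_section:
  assumes "u \<in> borel_measurable (lebesgue_on D)" "x \<in> D"
  shows "density u x \<in> borel_measurable (lebesgue_on D)"
  using measurable_Pair2[OF density_measurable[OF assms(1)], of x] assms(2) by simp

text \<open>The coupling vanishes at distance \<open>\<epsilon>\<close> and beyond, so the moving
  disk may be replaced by the fixed domain \<open>D\<close>, over which Fubini and Schur's test can
  be applied.\<close>

lemma nonlocal_force_eq: "nonlocal_force D J g \<epsilon> u x = (LINT y|lebesgue_on D. density u x y)"
proof -
  have "indicator (ball x \<epsilon> \<inter> D) y *\<^sub>R density u x y = indicator D y *\<^sub>R density u x y" for y
  proof (cases "y \<in> ball x \<epsilon>")
    case False
    then have "coupling (norm (y - x)) = 0"
      by (intro coupling_bounds) (auto simp: dist_norm norm_minus_commute)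
    then show ?thesis by (simp add: density_eq)
  qed (simp add: indicator_def)
  then have "nonlocal_force D J g \<epsilon> u x = (LINT y|lebesgue. indicator D y *\<^sub>R density u x y)"
    unfolding nonlocal_force_def set_lebesgue_integral_def density_def[symmetric] by (simp only:)
  then show ?thesis
    using D_lebesgue by (simp add: integral_restrict_space)
qed

definition K :: real where
  "K = (SOME K. K \<ge> 0 \<and> (\<forall>x. (\<integral>\<^sup>+y. ennreal (bond_kernel \<epsilon> (y - x)) \<partial>lebesgue_on D) \<le> ennreal K))"

lemma K_nonneg: "K \<ge> 0"
  and K_bound: "(\<integral>\<^sup>+y. ennreal (bond_kernel \<epsilon> (y - x)) \<partial>lebesgue_on D) \<le> ennreal K"
proof -
  have "\<exists>K. K \<ge> 0 \<and> (\<forall>x. (\<integral>\<^sup>+y. ennreal (bond_kernel \<epsilon> (y - x)) \<partial>lebesgue_on D) \<le> ennreal K)"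
    using nn_integral_bond_kernel_bound[OF eps] D_lebesgue by metis
  from someI_ex[OF this] show "K \<ge> 0"
    "(\<integral>\<^sup>+y. ennreal (bond_kernel \<epsilon> (y - x)) \<partial>lebesgue_on D) \<le> ennreal K"
    by (auto simp: K_def)
qed

definition force_max :: real where
  "force_max = coupling_max * sqrt \<epsilon> * L * K"

lemma nn_integral_density_le:
  "(\<integral>\<^sup>+y. ennreal (norm (density u x y)) \<partial>lebesgue_on D) \<le> ennreal force_max"
proof -
  let ?c = "coupling_max * sqrt \<epsilon> * L"
  have c: "?c \<ge> 0" using coupling_max_nonneg L_pos eps by simp
  have [measurable]: "(\<lambda>y. bond_kernel \<epsilon> (y - x)) \<in> borel_measurable (lebesgue_on D)"
    by (rule measurable_compose[OF lebesgue_on_id_measurable]) measurable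
  have "(\<integral>\<^sup>+y. ennreal (norm (density u x y)) \<partial>lebesgue_on D)
      \<le> (\<integral>\<^sup>+y. ennreal ?c * ennreal (bond_kernel \<epsilon> (y - x)) \<partial>lebesgue_on D)"
    using c bond_kernel_nonneg density_le[of u x]
    by (intro nn_integral_mono) (simp add: ennreal_leI flip: ennreal_mult)
  also have "\<dots> = ennreal ?c * (\<integral>\<^sup>+y. ennreal (bond_kernel \<epsilon> (y - x)) \<partial>lebesgue_on D)"
    by (rule nn_integral_cmult) measurable
  also have "\<dots> \<le> ennreal ?c * ennreal K"
    by (intro mult_left_mono K_bound) simp
  also have "\<dots> = ennreal force_max"
    using c K_nonneg by (simp add: force_max_def ennreal_mult)
  finally show ?thesis .
qed

lemma density_integrable:
  assumes "u \<in> borel_measurable (lebesgue_on D)" "x \<in> D"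
  shows "integrable (lebesgue_on D) (density u x)"
  unfolding integrable_iff_bounded
  using density_measurable_section[OF assms] nn_integral_density_le[of u x]
  by (auto intro: order.strict_trans1)

lemma nonlocal_force_measurable:
  assumes "u \<in> borel_measurable (lebesgue_on D)"
  shows "nonlocal_force D J g \<epsilon> u \<in> borel_measurable (lebesgue_on D)"
  unfolding nonlocal_force_eq[abs_def]
  by (rule borel_measurable_lebesgue_integral[OF density_measurable[OF assms]])

lemma norm_nonlocal_force_le:
  assumes "u \<in> borel_measurable (lebesgue_on D)" "x \<in> D"
  shows "norm (nonlocal_force D J g \<epsilon> u x) \<le> force_max"
proof -
  have "ennreal (norm (nonlocal_force D J g \<epsilon> u x)) \<le> ennreal force_max"
    unfolding nonlocal_force_eq
    using integral_norm_bound_ennreal[OF density_integrable[OF assms]] nn_integral_density_le[of u x]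
    by (rule order_trans)
  moreover have "force_max \<ge> 0"
    using coupling_max_nonneg L_pos eps K_nonneg by (simp add: force_max_def)
  ultimately show ?thesis by simp
qed

section \<open>The force as a Lipschitz map of square integrable fields\<close>

lemma bounded_measurable_L2:
  assumes "f \<in> borel_measurable (lebesgue_on D)" "\<And>x. x \<in> D \<Longrightarrow> norm (f x) \<le> B"
  shows "f \<in> L2 D"
proof -
  have "integrable (lebesgue_on D) (\<lambda>x. (norm (f x))\<^sup>2)"
  proof (rule integrable_const_bound)
    show "AE x in lebesgue_on D. norm ((norm (f x))\<^sup>2) \<le> B\<^sup>2"
      using assms(2) by (intro AE_I2) (auto intro: power_mono)
  qed (use assms(1) in measurable)
  then show ?thesis using assms(1) by (simp add: L2_def)
qed

lemma nonlocal_force_L2: "u \<in> L2 D \<Longrightarrow> nonlocal_force D J g \<epsilon> u \<in> L2 D"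
  by (rule bounded_measurable_L2[OF nonlocal_force_measurable norm_nonlocal_force_le])
    (auto simp: L2_def)

text \<open>Schur's test with \<open>bond_kernel\<close> as kernel and the norm of
  \<open>u - v\<close> as function. The factor \<open>coupling_max * L\<close> comes from the
  pointwise bound on the densities, the factor \<open>2 * K\<close> from the test.\<close>

lemma nn_integral_nonlocal_force_diff:
  assumes u: "u \<in> borel_measurable (lebesgue_on D)" and v: "v \<in> borel_measurable (lebesgue_on D)"
  shows "(\<integral>\<^sup>+x. ennreal ((norm (nonlocal_force D J g \<epsilon> u x - nonlocal_force D J g \<epsilon> v x))\<^sup>2) \<partial>lebesgue_on D)
    \<le> ennreal ((2 * coupling_max * L * K)\<^sup>2) * (\<integral>\<^sup>+x. ennreal ((norm (u x - v x))\<^sup>2) \<partial>lebesgue_on D)"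
proof -
  note [measurable] = u v
  let ?f = "\<lambda>x. norm (u x - v x)"
  let ?c = "coupling_max * L"
  have c: "?c \<ge> 0" using coupling_max_nonneg L_pos by simp
  let ?S = "\<lambda>x. \<integral>\<^sup>+y. ennreal (bond_kernel \<epsilon> (y - x) * (?f x + ?f y)) \<partial>lebesgue_on D"
  have km [measurable]: "(\<lambda>(x, y). bond_kernel \<epsilon> (y - x)) \<in> borel_measurable (lebesgue_on D \<Otimes>\<^sub>M lebesgue_on D)"
    unfolding case_prod_beta' by measurable
  have pw: "ennreal ((norm (nonlocal_force D J g \<epsilon> u x - nonlocal_force D J g \<epsilon> v x))\<^sup>2)
      \<le> ennreal (?c\<^sup>2) * (?S x)\<^sup>2" if x: "x \<in> D" for x
  proof -
    have [measurable]: "(\<lambda>y. bond_kernel \<epsilon> (y - x)) \<in> borel_measurable (lebesgue_on D)"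
      by (rule measurable_compose[OF lebesgue_on_id_measurable]) measurable
    have "nonlocal_force D J g \<epsilon> u x - nonlocal_force D J g \<epsilon> v x
        = (LINT y|lebesgue_on D. density u x y - density v x y)"
      using density_integrable[OF u x] density_integrable[OF v x] by (simp add: nonlocal_force_eq)
    then have "ennreal (norm (nonlocal_force D J g \<epsilon> u x - nonlocal_force D J g \<epsilon> v x))
        \<le> (\<integral>\<^sup>+y. ennreal (norm (density u x y - density v x y)) \<partial>lebesgue_on D)"
      using integral_norm_bound_ennreal[of "lebesgue_on D" "\<lambda>y. density u x y - density v x y"]
        density_integrable[OF u x] density_integrable[OF v x] by simp
    also have "\<dots> \<le> (\<integral>\<^sup>+y. ennreal ?c * ennreal (bond_kernel \<epsilon> (y - x) * (?f x + ?f y)) \<partial>lebesgue_on D)"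
    proof (rule nn_integral_mono)
      fix y
      have "ennreal ?c * ennreal (bond_kernel \<epsilon> (y - x) * (?f x + ?f y))
          = ennreal (?c * (bond_kernel \<epsilon> (y - x) * (?f x + ?f y)))"
        using c bond_kernel_nonneg[of \<epsilon> "y - x"] by (intro ennreal_mult[symmetric]) simp_all
      then show "ennreal (norm (density u x y - density v x y))
          \<le> ennreal ?c * ennreal (bond_kernel \<epsilon> (y - x) * (?f x + ?f y))"
        using density_diff_le[of u x y v] by (simp only: ennreal_leI)
    qed
    also have "\<dots> = ennreal ?c * ?S x"
      by (rule nn_integral_cmult) measurable
    finally have "(ennreal (norm (nonlocal_force D J g \<epsilon> u x - nonlocal_force D J g \<epsilon> v x)))\<^sup>2
        \<le> (ennreal ?c * ?S x)\<^sup>2"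
      by (intro power_mono) auto
    then show ?thesis
      using c by (simp add: ennreal_power power_mult_distrib)
  qed
  have "(\<integral>\<^sup>+x. ennreal ((norm (nonlocal_force D J g \<epsilon> u x - nonlocal_force D J g \<epsilon> v x))\<^sup>2) \<partial>lebesgue_on D)
      \<le> (\<integral>\<^sup>+x. ennreal (?c\<^sup>2) * (?S x)\<^sup>2 \<partial>lebesgue_on D)"
    using pw by (intro nn_integral_mono) simp
  also have "\<dots> = ennreal (?c\<^sup>2) * (\<integral>\<^sup>+x. (?S x)\<^sup>2 \<partial>lebesgue_on D)"
    by (rule nn_integral_cmult) measurable
  also have "\<dots> \<le> ennreal (?c\<^sup>2) * (ennreal (4 * K\<^sup>2) * (\<integral>\<^sup>+x. ennreal ((?f x)\<^sup>2) \<partial>lebesgue_on D))"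
  proof (rule mult_left_mono)
    show "(\<integral>\<^sup>+x. (?S x)\<^sup>2 \<partial>lebesgue_on D) \<le> ennreal (4 * K\<^sup>2) * (\<integral>\<^sup>+x. ennreal ((?f x)\<^sup>2) \<partial>lebesgue_on D)"
    proof (rule Schur_test[OF sigma_finite_measure_axioms km])
      show "(\<lambda>x. norm (u x - v x)) \<in> borel_measurable (lebesgue_on D)" by measurable
    qed (rule bond_kernel_nonneg norm_ge_zero bond_kernel_commute K_bound K_nonneg)+
  qed simp
  also have "\<dots> = ennreal ((2 * coupling_max * L * K)\<^sup>2) * (\<integral>\<^sup>+x. ennreal ((?f x)\<^sup>2) \<partial>lebesgue_on D)"
  proof -
    have "ennreal (?c\<^sup>2) * ennreal (4 * K\<^sup>2) = ennreal ((2 * coupling_max * L * K)\<^sup>2)"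
      by (subst ennreal_mult[symmetric]) (simp_all add: power_mult_distrib)
    then show ?thesis by (simp only: mult.assoc[symmetric])
  qed
  finally show ?thesis .
qed

lemma L2_norm_nonlocal_force_diff:
  assumes "u \<in> L2 D" "v \<in> L2 D" "(\<lambda>x. u x - v x) \<in> L2 D"
    "(\<lambda>x. nonlocal_force D J g \<epsilon> u x - nonlocal_force D J g \<epsilon> v x) \<in> L2 D"
  shows "L2_norm D (\<lambda>x. nonlocal_force D J g \<epsilon> u x - nonlocal_force D J g \<epsilon> v x)
    \<le> 2 * coupling_max * L * K * L2_norm D (\<lambda>x. u x - v x)"
proof -
  have eq: "(\<integral>\<^sup>+x. ennreal ((norm (f x))\<^sup>2) \<partial>lebesgue_on D) = ennreal ((L2_norm D f)\<^sup>2)"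
    if "f \<in> L2 D" for f
  proof -
    have "(L2_norm D f)\<^sup>2 = (LINT x|lebesgue_on D. (norm (f x))\<^sup>2)"
      unfolding L2_norm_def by (intro real_sqrt_pow2 Bochner_Integration.integral_nonneg) simp
    moreover have "integrable (lebesgue_on D) (\<lambda>x. (norm (f x))\<^sup>2)"
      using that by (simp add: L2_def)
    ultimately show ?thesis by (simp add: nn_integral_eq_integral)
  qed
  let ?A = "L2_norm D (\<lambda>x. nonlocal_force D J g \<epsilon> u x - nonlocal_force D J g \<epsilon> v x)"
    and ?B = "L2_norm D (\<lambda>x. u x - v x)"
  have "ennreal (?A\<^sup>2) \<le> ennreal ((2 * coupling_max * L * K)\<^sup>2) * ennreal (?B\<^sup>2)"
    unfolding eq[OF assms(3), symmetric] eq[OF assms(4), symmetric]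
  proof (rule nn_integral_nonlocal_force_diff)
    show "u \<in> borel_measurable (lebesgue_on D)" "v \<in> borel_measurable (lebesgue_on D)"
      using assms(1,2) by (simp_all add: L2_def)
  qed
  also have "\<dots> = ennreal ((2 * coupling_max * L * K * ?B)\<^sup>2)"
    by (subst ennreal_mult[symmetric]) (simp_all add: power_mult_distrib)
  finally have "?A\<^sup>2 \<le> (2 * coupling_max * L * K * ?B)\<^sup>2"
    by (simp only: ennreal_le_iff zero_le_power2)
  then show ?thesis
  proof (rule power2_le_imp_le)
    show "0 \<le> 2 * coupling_max * L * K * ?B"
      using coupling_max_nonneg L_pos K_nonneg
      by (intro mult_nonneg_nonneg L2_norm_nonneg) simp_all
  qed
qed

section \<open>Rigid motions and the balance of internal forces\<close>

lemma rigid_motion_bounded: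
  "\<exists>R\<ge>0. \<forall>x\<in>D. norm (rigid_motion \<Omega> c x) \<le> R"
proof -
  obtain B where B: "\<And>x. x \<in> D \<Longrightarrow> norm x \<le> B" "B > 0"
    using D_bounded by (auto simp: bounded_pos)
  have "norm (rigid_motion \<Omega> c x) \<le> 2 * \<bar>\<Omega>\<bar> * B + norm c" if "x \<in> D" for x
    using norm_rigid_motion_le[of \<Omega> c x] mult_left_mono[OF B(1)[OF that], of "2 * \<bar>\<Omega>\<bar>"] by simp
  moreover have "2 * \<bar>\<Omega>\<bar> * B + norm c \<ge> 0" using B(2) by simp
  ultimately show ?thesis by blast
qed

lemma rigid_motion_measurable: "rigid_motion \<Omega> c \<in> borel_measurable (lebesgue_on D)"
  using continuous_rigid_motion D_lebesgue by (rule continuous_imp_measurable_on_sets_lebesgue)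

lemma rigid_motion_L2: "rigid_motion \<Omega> c \<in> L2 D"
proof -
  obtain R where "\<And>x. x \<in> D \<Longrightarrow> norm (rigid_motion \<Omega> c x) \<le> R" "R \<ge> 0"
    using rigid_motion_bounded by blast
  show ?thesis by (rule bounded_measurable_L2[OF rigid_motion_measurable]) fact
qed

text \<open>Let A and B be the double integrals of the density against the rigid motion at
  \<open>x\<close> and at \<open>y\<close>. Exchanging the variables and antisymmetry give A = - B.
  The density points along \<open>y - x\<close>, where the rigid motion has no relative component,
  so also A = B. Fubini is justified because rigid motions are bounded on \<open>D\<close>.\<close>

lemma nonlocal_force_orthogonal_rigid_motion:
  assumes u: "u \<in> borel_measurable (lebesgue_on D)"
  shows "(LINT x|lebesgue_on D. nonlocal_force D J g \<epsilon> u x \<bullet> rigid_motion \<Omega> c x) = 0"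
proof -
  let ?N = "lebesgue_on D" and ?r = "rigid_motion \<Omega> c"
  note [measurable] = u rigid_motion_measurable
  obtain R where R: "\<And>x. x \<in> D \<Longrightarrow> norm (?r x) \<le> R" "R \<ge> 0"
    using rigid_motion_bounded by blast
  have m [measurable]: "(\<lambda>(x, y). density u x y \<bullet> ?r x) \<in> borel_measurable (?N \<Otimes>\<^sub>M ?N)"
    using density_measurable[OF u] measurable_compose[OF measurable_fst rigid_motion_measurable]
    unfolding case_prod_beta' by (rule borel_measurable_inner)
  have int: "integrable (?N \<Otimes>\<^sub>M ?N) (\<lambda>(x, y). density u x y \<bullet> ?r x)"
    unfolding integrable_iff_bounded
  proof (rule conjI[OF m])
    have "(\<integral>\<^sup>+p. ennreal (norm (case p of (x, y) \<Rightarrow> density u x y \<bullet> ?r x)) \<partial>(?N \<Otimes>\<^sub>M ?N))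
        = (\<integral>\<^sup>+x. (\<integral>\<^sup>+y. ennreal (norm (density u x y \<bullet> ?r x)) \<partial>?N) \<partial>?N)"
      using nn_integral_fst[of "\<lambda>p. ennreal (norm (case p of (x, y) \<Rightarrow> density u x y \<bullet> ?r x))" ?N] by simp
    also have "\<dots> \<le> (\<integral>\<^sup>+x. ennreal R * ennreal force_max \<partial>?N)"
    proof (rule nn_integral_mono)
      fix x assume "x \<in> space ?N"
      then have x: "x \<in> D" by simp
      have "(\<integral>\<^sup>+y. ennreal (norm (density u x y \<bullet> ?r x)) \<partial>?N)
          \<le> (\<integral>\<^sup>+y. ennreal R * ennreal (norm (density u x y)) \<partial>?N)"
      proof (rule nn_integral_mono)
        fix y
        have "norm (density u x y \<bullet> ?r x) \<le> norm (density u x y) * norm (?r x)"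
          by (simp add: Cauchy_Schwarz_ineq2)
        also have "\<dots> \<le> R * norm (density u x y)"
          using R(1)[OF x] by (simp add: mult.commute mult_right_mono)
        finally show "ennreal (norm (density u x y \<bullet> ?r x)) \<le> ennreal R * ennreal (norm (density u x y))"
          using R(2) by (simp add: ennreal_leI flip: ennreal_mult)
      qed
      also have "\<dots> = ennreal R * (\<integral>\<^sup>+y. ennreal (norm (density u x y)) \<partial>?N)"
        by (intro nn_integral_cmult measurable_compose[OF density_measurable_section[OF u x]]) simp
      also have "\<dots> \<le> ennreal R * ennreal force_max"
        by (intro mult_left_mono nn_integral_density_le) simp
      finally show "(\<integral>\<^sup>+y. ennreal (norm (density u x y \<bullet> ?r x)) \<partial>?N) \<le> ennreal R * ennreal force_max" .
    qed
    also have "\<dots> < \<infinity>"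
      by (simp add: ennreal_mult_less_top emeasure_eq_measure)
    finally show "(\<integral>\<^sup>+p. ennreal (norm (case p of (x, y) \<Rightarrow> density u x y \<bullet> ?r x)) \<partial>(?N \<Otimes>\<^sub>M ?N)) < \<infinity>" .
  qed
  have swap: "density u y x \<bullet> ?r y = - (density u x y \<bullet> ?r y)" for x y
    using density_antisym[of u y x] by (simp only: inner_minus_left)
  have int': "integrable (?N \<Otimes>\<^sub>M ?N) (\<lambda>(x, y). density u x y \<bullet> ?r y)"
  proof -
    have "(\<lambda>(x, y). density u x y \<bullet> ?r y) = (\<lambda>p. - (case p of (x, y) \<Rightarrow> density u y x \<bullet> ?r y))"
      by (rule ext) (simp only: case_prod_beta swap minus_minus)
    moreover have "integrable (?N \<Otimes>\<^sub>M ?N) (\<lambda>(x, y). density u y x \<bullet> ?r y)"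
      using pair.integrable_product_swap[OF int] by (simp only: prod.case)
    ultimately show ?thesis
      by (simp only: Bochner_Integration.integrable_minus)
  qed
  have I: "(LINT x|?N. nonlocal_force D J g \<epsilon> u x \<bullet> ?r x) = (LINT x|?N. LINT y|?N. density u x y \<bullet> ?r x)"
    using density_integrable[OF u]
    by (intro Bochner_Integration.integral_cong) (simp_all add: nonlocal_force_eq)
  also have "\<dots> = (LINT y|?N. LINT x|?N. density u x y \<bullet> ?r x)"
    using pair.Fubini_integral[OF int] ..
  also have "\<dots> = (LINT x|?N. LINT y|?N. - (density u x y \<bullet> ?r y))"
    by (simp only: swap)
  finally have I2: "(LINT x|?N. nonlocal_force D J g \<epsilon> u x \<bullet> ?r x)
      = - (LINT x|?N. LINT y|?N. density u x y \<bullet> ?r y)"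
    by simp
  have "(LINT x|?N. LINT y|?N. density u x y \<bullet> ?r x) - (LINT x|?N. LINT y|?N. density u x y \<bullet> ?r y)
      = integral\<^sup>L (?N \<Otimes>\<^sub>M ?N) (\<lambda>(x, y). density u x y \<bullet> ?r x)
        - integral\<^sup>L (?N \<Otimes>\<^sub>M ?N) (\<lambda>(x, y). density u x y \<bullet> ?r y)"
    using pair.integral_fst[OF int] pair.integral_fst[OF int'] by simp
  also have "\<dots> = integral\<^sup>L (?N \<Otimes>\<^sub>M ?N) (\<lambda>p. (case p of (x, y) \<Rightarrow> density u x y \<bullet> ?r x)
      - (case p of (x, y) \<Rightarrow> density u x y \<bullet> ?r y))"
    by (rule Bochner_Integration.integral_diff[OF int int', symmetric])
  also have "\<dots> = 0"
  proof -
    have "density u x y \<bullet> ?r x - density u x y \<bullet> ?r y = 0" for x y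
      using rigid_motion_no_strain[of y x \<Omega> c]
      by (simp add: density_eq unit_dir_def flip: inner_diff_right)
    then have "(\<lambda>p. (case p of (x, y) \<Rightarrow> density u x y \<bullet> ?r x)
        - (case p of (x, y) \<Rightarrow> density u x y \<bullet> ?r y)) = (\<lambda>p. 0)"
      by (auto simp: fun_eq_iff)
    then show ?thesis by simp
  qed
  finally show ?thesis using I I2 by simp
qed

end

section \<open>The initial value problem\<close>

text \<open>Extension by zero embeds \<open>L2 D\<close> into the type \<open>l2\<close> of classes on the whole plane, since a
  type cannot depend on \<open>D\<close>.\<close>

definition l2_of :: "(real^2) set \<Rightarrow> (real^2 \<Rightarrow> real^2) \<Rightarrow> (real^2, real^2) l2" where
  "l2_of D f = abs_l2 (\<lambda>x. indicator D x *\<^sub>R f x)"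

lemma square_integrable_extend:
  assumes D: "D \<in> sets lebesgue" and f: "f \<in> L2 D"
  shows "square_integrable lebesgue (\<lambda>x. indicator D x *\<^sub>R f x)"
proof -
  have "(norm (indicator D x *\<^sub>R f x))\<^sup>2 = indicator D x *\<^sub>R (norm (f x))\<^sup>2" for x
    by (simp add: indicator_def)
  then show ?thesis
    using D f by (simp add: square_integrable_def L2_def borel_measurable_restrict_space_iff
        integrable_restrict_space)
qed

lemma square_integrable_restrict:
  assumes D: "D \<in> sets lebesgue" and f: "square_integrable lebesgue f"
  shows "f \<in> L2 D"
proof -
  have "integrable lebesgue (\<lambda>x. indicator D x *\<^sub>R (norm (f x))\<^sup>2)"
    using assms by (intro integrable_mult_indicator) (auto simp: square_integrable_def)
  then show ?thesis
    using assms by (simp add: L2_def square_integrable_def integrable_restrict_space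
        measurable_restrict_space1)
qed

lemma rep_l2_L2: "D \<in> sets lebesgue \<Longrightarrow> rep_l2 U \<in> L2 D"
  using Quotient3_rep_reflp[OF Quotient3_l2, of U]
  by (intro square_integrable_restrict) (simp_all add: l2_rel_def)

section \<open>Calculus of the embedding into classes\<close>

lemma L2_diff: "f \<in> L2 D \<Longrightarrow> g \<in> L2 D \<Longrightarrow> (\<lambda>x. f x - g x) \<in> L2 D"
  unfolding L2_iff by (rule square_integrable_diff)

lemma L2_add: "f \<in> L2 D \<Longrightarrow> g \<in> L2 D \<Longrightarrow> (\<lambda>x. f x + g x) \<in> L2 D"
  unfolding L2_iff by (rule square_integrable_add)

lemma L2_scaleR: "f \<in> L2 D \<Longrightarrow> (\<lambda>x. c *\<^sub>R f x) \<in> L2 D"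
  unfolding L2_iff by (rule square_integrable_scaleR)

lemma inner_l2_of:
  assumes "D \<in> sets lebesgue" "f \<in> L2 D" "g \<in> L2 D"
  shows "inner (l2_of D f) (l2_of D g) = (LINT x|lebesgue_on D. f x \<bullet> g x)"
proof -
  have "(indicator D x *\<^sub>R f x) \<bullet> (indicator D x *\<^sub>R g x) = indicator D x *\<^sub>R (f x \<bullet> g x)" for x
    by (simp add: indicator_def)
  moreover have "inner (l2_of D f) (l2_of D g)
      = (LINT x|lebesgue. (indicator D x *\<^sub>R f x) \<bullet> (indicator D x *\<^sub>R g x))"
    using assms by (simp add: l2_of_def inner_l2.abs_eq l2_rel_def square_integrable_extend
        del: inner_scaleR_left inner_scaleR_right)
  ultimately have "inner (l2_of D f) (l2_of D g) = (LINT x|lebesgue. indicator D x *\<^sub>R (f x \<bullet> g x))"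
    by (simp only:)
  then show ?thesis
    using assms(1) by (simp add: integral_restrict_space)
qed

lemma norm_l2_of: "D \<in> sets lebesgue \<Longrightarrow> f \<in> L2 D \<Longrightarrow> norm (l2_of D f) = L2_norm D f"
  by (simp add: norm_eq_sqrt_inner inner_l2_of L2_norm_def)

lemma l2_of_diff:
  assumes "D \<in> sets lebesgue" "f \<in> L2 D" "g \<in> L2 D"
  shows "l2_of D f - l2_of D g = l2_of D (\<lambda>x. f x - g x)"
  using assms by (simp add: l2_of_def abs_l2_diff square_integrable_extend scaleR_diff_right)

lemma l2_of_add:
  assumes "D \<in> sets lebesgue" "f \<in> L2 D" "g \<in> L2 D"
  shows "l2_of D f + l2_of D g = l2_of D (\<lambda>x. f x + g x)"
  using assms by (simp add: l2_of_def plus_l2.abs_eq l2_rel_def square_integrable_extend scaleR_add_right)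

lemma l2_of_scaleR:
  assumes "D \<in> sets lebesgue" "f \<in> L2 D"
  shows "c *\<^sub>R l2_of D f = l2_of D (\<lambda>x. c *\<^sub>R f x)"
  using assms by (simp add: l2_of_def scaleR_l2.abs_eq l2_rel_def square_integrable_extend mult.commute)

lemma norm_l2_of_diff:
  assumes "D \<in> sets lebesgue" "f \<in> L2 D" "g \<in> L2 D"
  shows "norm (l2_of D f - l2_of D g) = L2_norm D (\<lambda>x. f x - g x)"
  using assms by (simp add: l2_of_diff norm_l2_of L2_diff)

text \<open>Definiteness of the inner product, applied to the difference. This is the way back from
  identities between classes to statements almost everywhere on \<open>D\<close>.\<close>

lemma l2_of_eq_iff:
  assumes "D \<in> sets lebesgue" "f \<in> L2 D" "g \<in> L2 D"
  shows "l2_of D f = l2_of D g \<longleftrightarrow> (AE x in lebesgue_on D. f x = g x)"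
proof -
  have "l2_of D f = l2_of D g \<longleftrightarrow> inner (l2_of D f - l2_of D g) (l2_of D f - l2_of D g) = 0"
    by simp
  also have "\<dots> \<longleftrightarrow> (LINT x|lebesgue_on D. (f x - g x) \<bullet> (f x - g x)) = 0"
    using assms by (simp add: l2_of_diff inner_l2_of L2_diff del: inner_eq_zero_iff)
  also have "\<dots> \<longleftrightarrow> (AE x in lebesgue_on D. f x - g x = 0)"
    using L2_diff[OF assms(2,3)] by (intro square_integrable_AE_zero_iff) (simp add: L2_iff)
  finally show ?thesis by simp
qed

text \<open>For measurable \<open>D\<close> this is the orthogonal projection onto the classes
  vanishing outside \<open>D\<close>. The representative is an arbitrary choice, whose irrelevance
  is shown by \<open>restrict_l2_abs\<close>.\<close>

definition restrict_l2 :: "(real^2) set \<Rightarrow> (real^2, real^2) l2 \<Rightarrow> (real^2, real^2) l2" where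
  "restrict_l2 D U = l2_of D (rep_l2 U)"

lemma restrict_l2_abs:
  assumes "D \<in> sets lebesgue" "square_integrable lebesgue f"
  shows "restrict_l2 D (abs_l2 f) = l2_of D f"
proof -
  have "l2_rel (rep_l2 (abs_l2 f)) f"
    using Quotient3_rep_abs[OF Quotient3_l2, of f] assms by (simp add: l2_rel_def)
  then have "AE x in lebesgue. rep_l2 (abs_l2 f) x = f x"
    by (simp add: l2_rel_def)
  then have "AE x in lebesgue_on D. rep_l2 (abs_l2 f) x = f x"
    using assms by (auto simp: AE_restrict_space_iff)
  then show ?thesis
    using assms unfolding restrict_l2_def
    by (subst l2_of_eq_iff) (auto intro: rep_l2_L2 square_integrable_restrict)
qed

lemma restrict_l2_of:
  assumes "D \<in> sets lebesgue" "f \<in> L2 D"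
  shows "restrict_l2 D (l2_of D f) = l2_of D f"
proof -
  have "restrict_l2 D (l2_of D f) = l2_of D (\<lambda>x. indicator D x *\<^sub>R f x)"
    unfolding l2_of_def[of D f] using assms by (intro restrict_l2_abs square_integrable_extend)
  also have "\<dots> = l2_of D f"
  proof -
    have "indicator D x *\<^sub>R (indicator D x *\<^sub>R f x) = indicator D x *\<^sub>R f x" for x
      by (simp add: indicator_def)
    then show ?thesis by (simp only: l2_of_def)
  qed
  finally show ?thesis .
qed

lemma bounded_linear_restrict_l2:
  assumes D: "D \<in> sets lebesgue"
  shows "bounded_linear (restrict_l2 D)" "norm (restrict_l2 D U) \<le> norm U"
proof -
  have add: "restrict_l2 D (U + V) = restrict_l2 D U + restrict_l2 D V" for U V
  proof -
    obtain f g where "square_integrable lebesgue f" "U = abs_l2 f"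
      "square_integrable lebesgue g" "V = abs_l2 g"
      by (metis l2_cases)
    then show ?thesis
      using D by (simp add: restrict_l2_abs plus_l2.abs_eq l2_rel_def l2_of_add
          square_integrable_add square_integrable_restrict)
  qed
  have scale: "restrict_l2 D (c *\<^sub>R U) = c *\<^sub>R restrict_l2 D U" for c U
  proof -
    obtain f where "square_integrable lebesgue f" "U = abs_l2 f"
      by (rule l2_cases)
    then show ?thesis
      using D by (simp add: restrict_l2_abs scaleR_l2.abs_eq l2_rel_def l2_of_scaleR
          square_integrable_scaleR square_integrable_restrict)
  qed
  have le: "norm (restrict_l2 D U) \<le> norm U" for U
  proof -
    obtain f where f: "square_integrable lebesgue f" "U = abs_l2 f"
      by (rule l2_cases)
    have "(LINT x|lebesgue_on D. (norm (f x))\<^sup>2) \<le> (LINT x|lebesgue. (norm (f x))\<^sup>2)"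
      using D f unfolding square_integrable_def
      by (subst integral_restrict_space, simp)
        (intro integral_mono integrable_mult_indicator, auto simp: indicator_def)
    then have "(L2_norm D f)\<^sup>2 \<le> (norm U)\<^sup>2"
      using f by (simp add: norm_abs_l2 L2_norm_def)
    then have "L2_norm D f \<le> norm U"
      by (rule power2_le_imp_le) simp
    then show ?thesis
      using D f by (simp add: restrict_l2_abs norm_l2_of square_integrable_restrict)
  qed
  show "bounded_linear (restrict_l2 D)"
    using add scale le by (intro bounded_linear_intro[where K = 1]) auto
  show "norm (restrict_l2 D U) \<le> norm U" by (rule le)
qed

section \<open>Time regularity: from seminorms to classes\<close>

lemma L2_continuous_on_iff:
  assumes "D \<in> sets lebesgue" "\<And>t. t \<in> I \<Longrightarrow> u t \<in> L2 D"
  shows "L2_continuous_on D I u \<longleftrightarrow> continuous_on I (\<lambda>t. l2_of D (u t))"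
proof -
  have "((\<lambda>s. L2_norm D (\<lambda>x. u s x - u t x)) \<longlongrightarrow> 0) (at t within I)
      \<longleftrightarrow> ((\<lambda>s. l2_of D (u s)) \<longlongrightarrow> l2_of D (u t)) (at t within I)" if t: "t \<in> I" for t
  proof -
    have "\<forall>\<^sub>F s in at t within I. L2_norm D (\<lambda>x. u s x - u t x) = norm (l2_of D (u s) - l2_of D (u t))"
      using assms t by (auto simp: eventually_at_filter norm_l2_of_diff)
    from tendsto_cong[OF this] show ?thesis
      by (simp add: tendsto_norm_zero_iff LIM_zero_iff)
  qed
  then show ?thesis
    by (simp add: L2_continuous_on_def continuous_on_def)
qed

text \<open>The derivative is defined through a remainder divided by \<open>norm (s - t)\<close>,
  whereas the seminorm notion divides by \<open>s - t\<close>. The two differ by the sign of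
  \<open>s - t\<close>, which disappears under the norm.\<close>

lemma has_vector_derivative_within_quotient:
  fixes f :: "real \<Rightarrow> 'a::real_normed_vector"
  shows "(f has_vector_derivative v) (at t within I) \<longleftrightarrow>
    ((\<lambda>s. norm ((f s - f t) /\<^sub>R (s - t) - v)) \<longlongrightarrow> 0) (at t within I)"
proof -
  have "(1 / norm (s - t)) *\<^sub>R (f s - (f t + (s - t) *\<^sub>R v))
      = sgn (s - t) *\<^sub>R ((f s - f t) /\<^sub>R (s - t) - v)" if "s \<noteq> t" for s
  proof -
    have "(f s - f t) /\<^sub>R (s - t) - v = (1 / (s - t)) *\<^sub>R (f s - (f t + (s - t) *\<^sub>R v))"
      using that by (simp add: scaleR_diff_right scaleR_add_right divide_inverse)
    moreover have "sgn (s - t) * (1 / (s - t)) = 1 / norm (s - t)"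
      using that by (auto simp: sgn_if minus_divide_right)
    ultimately show ?thesis by simp
  qed
  then have eq: "norm ((1 / norm (s - t)) *\<^sub>R (f s - (f t + (s - t) *\<^sub>R v)))
      = norm ((f s - f t) /\<^sub>R (s - t) - v)" if "s \<noteq> t" for s
    using that by (simp add: abs_sgn_eq del: norm_scaleR) (simp add: abs_sgn_eq)
  have "(f has_vector_derivative v) (at t within I) \<longleftrightarrow>
      ((\<lambda>s. (1 / norm (s - t)) *\<^sub>R (f s - (f t + (s - t) *\<^sub>R v))) \<longlongrightarrow> 0) (at t within I)"
    by (simp add: has_vector_derivative_def has_derivative_within bounded_linear_scaleR_left)
  also have "\<dots> \<longleftrightarrow>
      ((\<lambda>s. norm ((1 / norm (s - t)) *\<^sub>R (f s - (f t + (s - t) *\<^sub>R v)))) \<longlongrightarrow> 0) (at t within I)"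
    by (rule tendsto_norm_zero_iff[symmetric])
  also have "\<dots> \<longleftrightarrow> ((\<lambda>s. norm ((f s - f t) /\<^sub>R (s - t) - v)) \<longlongrightarrow> 0) (at t within I)"
    by (intro tendsto_cong, unfold eventually_at_filter) (intro always_eventually allI impI eq)
  finally show ?thesis .
qed

lemma L2_derivative_on_iff:
  assumes D: "D \<in> sets lebesgue"
    and u: "\<And>t. t \<in> I \<Longrightarrow> u t \<in> L2 D" and v: "\<And>t. t \<in> I \<Longrightarrow> v t \<in> L2 D"
  shows "L2_derivative_on D I u v \<longleftrightarrow>
    (\<forall>t\<in>I. ((\<lambda>t. l2_of D (u t)) has_vector_derivative l2_of D (v t)) (at t within I))"
proof -
  have "((\<lambda>s. L2_norm D (\<lambda>x. (u s x - u t x) /\<^sub>R (s - t) - v t x)) \<longlongrightarrow> 0) (at t within I)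
      \<longleftrightarrow> ((\<lambda>t. l2_of D (u t)) has_vector_derivative l2_of D (v t)) (at t within I)"
    if t: "t \<in> I" for t
    unfolding has_vector_derivative_within_quotient
  proof (rule tendsto_cong)
    have "L2_norm D (\<lambda>x. (u s x - u t x) /\<^sub>R (s - t) - v t x)
        = norm ((l2_of D (u s) - l2_of D (u t)) /\<^sub>R (s - t) - l2_of D (v t))" if "s \<in> I" for s
      using D u[OF that] u[OF t] v[OF t]
      by (simp add: l2_of_diff l2_of_scaleR norm_l2_of L2_diff L2_scaleR)
    then show "\<forall>\<^sub>F s in at t within I. L2_norm D (\<lambda>x. (u s x - u t x) /\<^sub>R (s - t) - v t x)
        = norm ((l2_of D (u s) - l2_of D (u t)) /\<^sub>R (s - t) - l2_of D (v t))"
      by (auto simp: eventually_at_filter)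
  qed
  then show ?thesis by (simp add: L2_derivative_on_def)
qed

text \<open>Pairing with a fixed vector is bounded and linear, so it commutes with differentiation.
  The lemma passes orthogonality from acceleration to velocity and then from velocity to
  displacement.\<close>

lemma derivative_orthogonal_const:
  fixes U V :: "real \<Rightarrow> 'b::real_inner"
  assumes "\<And>t. t \<in> {0..T} \<Longrightarrow> (U has_vector_derivative V t) (at t within {0..T})"
    and "\<And>t. t \<in> {0..T} \<Longrightarrow> inner (V t) R = 0" and "t \<in> {0..T}" and "inner (U 0) R = 0"
  shows "inner (U t) R = 0"
proof -
  have "((\<lambda>t. inner (U t) R) has_vector_derivative 0) (at t within {0..T})" if "t \<in> {0..T}" for t
    using bounded_linear.has_vector_derivative[OF bounded_linear_inner_left assms(1)[OF that], of R]
      assms(2)[OF that] by simp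
  then obtain c where "\<And>t. t \<in> {0..T} \<Longrightarrow> inner (U t) R = c"
    using has_vector_derivative_zero_constant[of "{0..T}" "\<lambda>t. inner (U t) R"] by auto
  from this[of t] this[of 0] assms show ?thesis by simp
qed

section \<open>The evolution equation in the space of classes\<close>

context bond_model
begin

lemma L2dot_iff:
  "f \<in> L2dot D \<longleftrightarrow> f \<in> L2 D \<and> (\<forall>\<Omega> c. inner (l2_of D f) (l2_of D (rigid_motion \<Omega> c)) = 0)"
  using D_lebesgue by (auto simp: L2dot_def inner_l2_of rigid_motion_L2)

lemma nonlocal_force_L2dot: "u \<in> L2 D \<Longrightarrow> nonlocal_force D J g \<epsilon> u \<in> L2dot D"
  using nonlocal_force_L2[of u] nonlocal_force_orthogonal_rigid_motion[of u]
  by (simp add: L2dot_def L2_def)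

definition force_op :: "(real^2, real^2) l2 \<Rightarrow> (real^2, real^2) l2" where
  "force_op U = l2_of D (nonlocal_force D J g \<epsilon> (rep_l2 U))"

lemma norm_l2_of_nonlocal_force_diff:
  assumes "u \<in> L2 D" "v \<in> L2 D"
  shows "norm (l2_of D (nonlocal_force D J g \<epsilon> u) - l2_of D (nonlocal_force D J g \<epsilon> v))
    \<le> 2 * coupling_max * L * K * norm (l2_of D u - l2_of D v)"
  using assms L2_norm_nonlocal_force_diff[OF assms] D_lebesgue
  by (simp add: norm_l2_of_diff nonlocal_force_L2 L2_diff)

text \<open>Independence of the representative is read off the Lipschitz estimate: two fields at
  distance zero over \<open>D\<close> have forces at distance zero.\<close>

lemma force_op_l2_of:
  assumes "u \<in> L2 D"
  shows "force_op (l2_of D u) = l2_of D (nonlocal_force D J g \<epsilon> u)"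
proof -
  have "l2_of D (rep_l2 (l2_of D u)) = l2_of D u"
    using restrict_l2_of[OF D_lebesgue assms] by (simp add: restrict_l2_def)
  then show ?thesis
    using norm_l2_of_nonlocal_force_diff[OF rep_l2_L2[OF D_lebesgue, of "l2_of D u"] assms]
    by (simp add: force_op_def)
qed

text \<open>The estimate on fields sees only the projections to \<open>D\<close>, and projecting
  does not increase distances.\<close>

lemma force_op_Lipschitz:
  "norm (force_op U - force_op V) \<le> 2 * coupling_max * L * K * norm (U - V)"
proof -
  have "norm (force_op U - force_op V)
      \<le> 2 * coupling_max * L * K * norm (restrict_l2 D U - restrict_l2 D V)"
    unfolding force_op_def restrict_l2_def
    using rep_l2_L2[OF D_lebesgue] by (intro norm_l2_of_nonlocal_force_diff)
  also have "restrict_l2 D U - restrict_l2 D V = restrict_l2 D (U - V)"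
    using bounded_linear.linear[OF bounded_linear_restrict_l2(1)[OF D_lebesgue]]
    by (simp add: linear_diff)
  also have "2 * coupling_max * L * K * norm (restrict_l2 D (U - V))
      \<le> 2 * coupling_max * L * K * norm (U - V)"
    using coupling_max_nonneg L_pos K_nonneg bounded_linear_restrict_l2(2)[OF D_lebesgue]
    by (intro mult_left_mono) simp_all
  finally show ?thesis .
qed

text \<open>The load stays abstract: it enters as a continuous curve of classes, orthogonal to rigid
  motions at each time.\<close>

theorem initial_value_problem:
  fixes F :: "real^2 \<Rightarrow> real \<Rightarrow> real^2"
  assumes \<rho>: "\<rho> > 0" and T: "T \<ge> 0"
    and F: "\<And>t. t \<in> {0..T} \<Longrightarrow> (\<lambda>x. F x t) \<in> L2dot D"
    and F_cont: "continuous_on {0..T} (\<lambda>t. l2_of D (\<lambda>x. F x t))"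
    and u0: "u0 \<in> L2dot D" and v0: "v0 \<in> L2dot D"
  shows "\<exists>u. is_solution D J g \<epsilon> \<rho> F u0 v0 T u \<and>
    (\<forall>u'. is_solution D J g \<epsilon> \<rho> F u0 v0 T u' \<longrightarrow>
      (\<forall>t\<in>{0..T}. AE x in lebesgue_on D. u' t x = u t x))"
proof -
  note D = D_lebesgue
  define \<Lambda> where "\<Lambda> = 2 * coupling_max * L * K"
  have \<Lambda>: "\<Lambda> \<ge> 0" using coupling_max_nonneg L_pos K_nonneg by (simp add: \<Lambda>_def)
  define A where "A t U = (1 / \<rho>) *\<^sub>R (force_op U + l2_of D (\<lambda>x. F x t))" for t U
  \<comment> \<open>The second order equation becomes a first order system for displacement and
    velocity.\<close>
  define G where "G t Z = (snd Z, A t (fst Z))" for t and Z :: "(real^2, real^2) l2 \<times> (real^2, real^2) l2"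
  have A_Lip: "norm (A t U - A t V) \<le> \<Lambda> / \<rho> * norm (U - V)" for t U V
  proof -
    have "norm (A t U - A t V) = (1 / \<rho>) * norm (force_op U - force_op V)"
      using \<rho> by (simp add: A_def flip: scaleR_diff_right)
    also have "\<dots> \<le> (1 / \<rho>) * (\<Lambda> * norm (U - V))"
      using force_op_Lipschitz \<rho> by (intro mult_left_mono) (simp_all add: \<Lambda>_def)
    finally show ?thesis by simp
  qed
  have A_cont: "continuous_on {0..T} (\<lambda>t. A t U)" for U
    unfolding A_def by (intro continuous_intros F_cont)
  \<comment> \<open>The summand 1 accounts for the velocity entering the first component. It also
    keeps the constant positive when \<open>\<Lambda> = 0\<close>, as Picard iteration
    requires.\<close>
  have G_Lip: "norm (G t X - G t Y) \<le> (1 + \<Lambda> / \<rho>) * norm (X - Y)" for t X Y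
  proof -
    have "norm (G t X - G t Y) \<le> norm (snd X - snd Y) + norm (A t (fst X) - A t (fst Y))"
      by (simp add: G_def norm_Pair_le)
    also have "\<dots> \<le> norm (X - Y) + \<Lambda> / \<rho> * norm (X - Y)"
    proof (rule add_mono)
      show "norm (snd X - snd Y) \<le> norm (X - Y)"
        using norm_snd_le[of "snd X - snd Y" "fst X - fst Y"] by (simp add: minus_prod_def)
      have "norm (fst X - fst Y) \<le> norm (X - Y)"
        using norm_fst_le[of "fst X - fst Y" "snd X - snd Y"] by (simp add: minus_prod_def)
      then show "norm (A t (fst X) - A t (fst Y)) \<le> \<Lambda> / \<rho> * norm (X - Y)"
        using A_Lip[of t "fst X" "fst Y"] \<Lambda> \<rho> mult_left_mono[of _ _ "\<Lambda> / \<rho>"]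
        by (meson divide_nonneg_pos order_trans)
    qed
    finally show ?thesis by (simp add: algebra_simps)
  qed
  have G_cont: "continuous_on {0..T} (\<lambda>t. G t X)" for X
    unfolding G_def by (intro continuous_intros A_cont)
  have pos: "1 + \<Lambda> / \<rho> > 0" using \<Lambda> \<rho> by (simp add: add_pos_nonneg)
  obtain Z where Z0: "Z 0 = (l2_of D u0, l2_of D v0)"
    and Z: "\<And>t. t \<in> {0..T} \<Longrightarrow> (Z has_vector_derivative G t (Z t)) (at t within {0..T})"
    and Z_unique: "\<And>X t. X 0 = (l2_of D u0, l2_of D v0) \<Longrightarrow>
      (\<And>t. t \<in> {0..T} \<Longrightarrow> (X has_vector_derivative G t (X t)) (at t within {0..T})) \<Longrightarrow>
      t \<in> {0..T} \<Longrightarrow> X t = Z t"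
    using Picard_Lindelof_global[where F = G and ?z0.0 = "(l2_of D u0, l2_of D v0)",
        OF T pos G_Lip G_cont] by blast
  define U where "U t = fst (Z t)" for t
  define V where "V t = snd (Z t)" for t
  have U': "(U has_vector_derivative V t) (at t within {0..T})" if "t \<in> {0..T}" for t
    using bounded_linear.has_vector_derivative[OF bounded_linear_fst Z[OF that]]
    by (simp add: U_def[abs_def] V_def G_def)
  have V': "(V has_vector_derivative A t (U t)) (at t within {0..T})" if "t \<in> {0..T}" for t
    using bounded_linear.has_vector_derivative[OF bounded_linear_snd Z[OF that]]
    by (simp add: U_def V_def[abs_def] G_def)
  let ?P = "restrict_l2 D"
  note P = bounded_linear_restrict_l2(1)[OF D]
  \<comment> \<open>Representatives are chosen separately at each time; no regularity in time is
    claimed for them at a fixed point \<open>x\<close>, only for their classes over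
    \<open>D\<close>.\<close>
  define u where "u t = rep_l2 (U t)" for t
  define v where "v t = rep_l2 (V t)" for t
  \<comment> \<open>With the acceleration defined by the equation of motion, that equation holds at
    every point; what has to be proved is that \<open>w\<close> is the time derivative of
    \<open>v\<close>.\<close>
  define w where "w t x = (1 / \<rho>) *\<^sub>R (nonlocal_force D J g \<epsilon> (u t) x + F x t)" for t x
  have u_L2: "u t \<in> L2 D" and v_L2: "v t \<in> L2 D" for t
    by (simp_all add: u_def v_def rep_l2_L2 D)
  have F_L2: "(\<lambda>x. F x t) \<in> L2 D" if "t \<in> {0..T}" for t
    using F[OF that] by (simp add: L2dot_def)
  have w_L2: "w t \<in> L2 D" if "t \<in> {0..T}" for t
    unfolding w_def[abs_def]
    by (intro L2_scaleR L2_add nonlocal_force_L2 u_L2 F_L2 that)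
  have l2u: "l2_of D (u t) = ?P (U t)" and l2v: "l2_of D (v t) = ?P (V t)" for t
    by (simp_all add: u_def v_def restrict_l2_def)
  have l2w: "l2_of D (w t) = A t (U t)" if "t \<in> {0..T}" for t
    using D F_L2[OF that] nonlocal_force_L2[OF u_L2]
    by (simp add: w_def[abs_def] A_def force_op_def u_def l2_of_add l2_of_scaleR L2_add)
  have du: "((\<lambda>t. l2_of D (u t)) has_vector_derivative l2_of D (v t)) (at t within {0..T})"
    if "t \<in> {0..T}" for t
    unfolding l2u l2v by (rule bounded_linear.has_vector_derivative[OF P U'[OF that]])
  have dv: "((\<lambda>t. l2_of D (v t)) has_vector_derivative l2_of D (w t)) (at t within {0..T})"
    if "t \<in> {0..T}" for t
  proof -
    \<comment> \<open>The acceleration is already the class of a field extended by zero, so the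
      projection fixes it.\<close>
    have "?P (A t (U t)) = l2_of D (w t)"
      using restrict_l2_of[OF D w_L2[OF that]] l2w[OF that] by simp
    then show ?thesis
      unfolding l2v using bounded_linear.has_vector_derivative[OF P V'[OF that]] by simp
  qed
  have cont: "continuous_on {0..T} X"
    if "\<And>t. t \<in> {0..T} \<Longrightarrow> (X has_vector_derivative Y t) (at t within {0..T})"
    for X Y :: "real \<Rightarrow> (real^2, real^2) l2"
    using that has_vector_derivative_continuous by (fastforce simp: continuous_on_eq_continuous_within)
  have "continuous_on {0..T} (\<lambda>t. A t (U t))"
    by (rule continuous_on_Lipschitz_compose[OF A_Lip A_cont cont[OF U']])
  then have cw: "continuous_on {0..T} (\<lambda>t. l2_of D (w t))"
    by (rule continuous_on_eq) (simp add: l2w)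
  have bdd: "bdd_above ((\<lambda>t. L2_norm D (X t)) ` {0..T})"
    if X: "\<And>t. t \<in> {0..T} \<Longrightarrow> X t \<in> L2 D" and c: "continuous_on {0..T} (\<lambda>t. l2_of D (X t))" for X
  proof -
    have "continuous_on {0..T} (\<lambda>t. norm (l2_of D (X t)))"
      by (intro continuous_intros c)
    then have "compact ((\<lambda>t. norm (l2_of D (X t))) ` {0..T})"
      by (intro compact_continuous_image) auto
    moreover have "(\<lambda>t. norm (l2_of D (X t))) ` {0..T} = (\<lambda>t. L2_norm D (X t)) ` {0..T}"
      using X D by (intro image_cong) (simp_all add: norm_l2_of)
    ultimately show ?thesis
      by (metis bounded_imp_bdd_above compact_imp_bounded)
  qed
  have u0_L2: "u0 \<in> L2 D" and v0_L2: "v0 \<in> L2 D"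
    using u0 v0 by (simp_all add: L2dot_def)
  have init: "l2_of D (u 0) = l2_of D u0" "l2_of D (v 0) = l2_of D v0"
    using Z0 restrict_l2_of[OF D u0_L2] restrict_l2_of[OF D v0_L2]
    by (simp_all add: l2u l2v U_def V_def)
  have orth_w: "inner (l2_of D (w t)) (l2_of D (rigid_motion \<Omega> c)) = 0" if t: "t \<in> {0..T}" for t \<Omega> c
  proof -
    have "l2_of D (w t) = (1 / \<rho>) *\<^sub>R (l2_of D (nonlocal_force D J g \<epsilon> (u t)) + l2_of D (\<lambda>x. F x t))"
      using l2w[OF t] by (simp add: A_def force_op_def u_def)
    then show ?thesis
      using nonlocal_force_L2dot[OF u_L2[of t]] F[OF t] by (simp add: L2dot_iff inner_add_left)
  qed
  have orth_v: "inner (l2_of D (v t)) (l2_of D (rigid_motion \<Omega> c)) = 0" if t: "t \<in> {0..T}" for t \<Omega> c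
  proof (rule derivative_orthogonal_const[OF dv orth_w t])
    show "inner (l2_of D (v 0)) (l2_of D (rigid_motion \<Omega> c)) = 0"
      using v0 by (simp add: init L2dot_iff)
  qed
  have orth_u: "inner (l2_of D (u t)) (l2_of D (rigid_motion \<Omega> c)) = 0" if t: "t \<in> {0..T}" for t \<Omega> c
  proof (rule derivative_orthogonal_const[OF du orth_v t])
    show "inner (l2_of D (u 0)) (l2_of D (rigid_motion \<Omega> c)) = 0"
      using u0 by (simp add: init L2dot_iff)
  qed
  have "C2_L2dot D T u v w"
    unfolding C2_L2dot_def
  proof (intro conjI ballI)
    show "L2_derivative_on D {0..T} u v"
      using du by (subst L2_derivative_on_iff[OF D u_L2 v_L2]) blast
    show "L2_derivative_on D {0..T} v w"
      using dv by (subst L2_derivative_on_iff[OF D v_L2 w_L2]) auto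
    show "L2_continuous_on D {0..T} w"
      using cw by (subst L2_continuous_on_iff[OF D w_L2]) auto
    show "bdd_above ((\<lambda>t. L2_norm D (u t)) ` {0..T})"
      by (rule bdd[OF u_L2 cont[OF du]])
    show "bdd_above ((\<lambda>t. L2_norm D (v t)) ` {0..T})"
      by (rule bdd[OF v_L2 cont[OF dv]])
    show "bdd_above ((\<lambda>t. L2_norm D (w t)) ` {0..T})"
      by (rule bdd[OF w_L2 cw])
  qed (simp_all add: L2dot_iff u_L2 v_L2 w_L2 orth_u orth_v orth_w)
  moreover have "AE x in lebesgue_on D. u 0 x = u0 x" "AE x in lebesgue_on D. v 0 x = v0 x"
    using init l2_of_eq_iff[OF D u_L2 u0_L2] l2_of_eq_iff[OF D v_L2 v0_L2] by simp_all
  moreover have "\<rho> *\<^sub>R w t x = nonlocal_force D J g \<epsilon> (u t) x + F x t" for t x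
    using \<rho> by (simp add: w_def)
  ultimately have sol: "is_solution D J g \<epsilon> \<rho> F u0 v0 T u"
    unfolding is_solution_def by blast
  have "AE x in lebesgue_on D. u' t x = u t x"
    if sol': "is_solution D J g \<epsilon> \<rho> F u0 v0 T u'" and t: "t \<in> {0..T}" for u' t
  proof -
    obtain v' w' where C2: "C2_L2dot D T u' v' w'"
      and pde: "\<And>t. t \<in> {0..T} \<Longrightarrow>
        AE x in lebesgue_on D. \<rho> *\<^sub>R w' t x = nonlocal_force D J g \<epsilon> (u' t) x + F x t"
      and u'0: "AE x in lebesgue_on D. u' 0 x = u0 x" and v'0: "AE x in lebesgue_on D. v' 0 x = v0 x"
      using sol' unfolding is_solution_def by blast
    have L2': "u' t \<in> L2 D" "v' t \<in> L2 D" "w' t \<in> L2 D" if "t \<in> {0..T}" for t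
      using C2 that by (auto simp: C2_L2dot_def L2dot_def)
    have d: "L2_derivative_on D {0..T} u' v'" "L2_derivative_on D {0..T} v' w'"
      using C2 by (simp_all add: C2_L2dot_def)
    have du': "((\<lambda>t. l2_of D (u' t)) has_vector_derivative l2_of D (v' t)) (at t within {0..T})"
      if "t \<in> {0..T}" for t
      using iffD1[OF L2_derivative_on_iff[OF D L2'(1) L2'(2)] d(1)] that by simp
    have dv': "((\<lambda>t. l2_of D (v' t)) has_vector_derivative l2_of D (w' t)) (at t within {0..T})"
      if "t \<in> {0..T}" for t
      using iffD1[OF L2_derivative_on_iff[OF D L2'(2) L2'(3)] d(2)] that by simp
    have w': "l2_of D (w' t) = A t (l2_of D (u' t))" if t: "t \<in> {0..T}" for t
    proof -
      \<comment> \<open>An equation valid almost everywhere becomes an identity of classes, and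
        \<open>force_op\<close> evaluates the force on the given representative.\<close>
      have "l2_of D (\<lambda>x. \<rho> *\<^sub>R w' t x) = l2_of D (\<lambda>x. nonlocal_force D J g \<epsilon> (u' t) x + F x t)"
        using pde[OF t] L2'[OF t] F_L2[OF t]
        by (subst l2_of_eq_iff[OF D]) (auto intro: L2_scaleR L2_add nonlocal_force_L2)
      then have "\<rho> *\<^sub>R l2_of D (w' t) = force_op (l2_of D (u' t)) + l2_of D (\<lambda>x. F x t)"
        using D L2'[OF t] F_L2[OF t]
        by (simp add: l2_of_scaleR l2_of_add nonlocal_force_L2 force_op_l2_of)
      then show ?thesis
        using \<rho> by (simp add: A_def flip: \<open>\<rho> *\<^sub>R l2_of D (w' t) = _\<close>)
    qed
    have "(\<lambda>t. (l2_of D (u' t), l2_of D (v' t))) t = Z t"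
    proof (rule Z_unique[OF _ _ t])
      have "0 \<in> {0..T}" using T by simp
      then show "(l2_of D (u' 0), l2_of D (v' 0)) = (l2_of D u0, l2_of D v0)"
        using l2_of_eq_iff[OF D L2'(1) u0_L2] l2_of_eq_iff[OF D L2'(2) v0_L2] u'0 v'0 by simp
      fix t assume t: "t \<in> {0..T}"
      show "((\<lambda>t. (l2_of D (u' t), l2_of D (v' t))) has_vector_derivative
          G t (l2_of D (u' t), l2_of D (v' t))) (at t within {0..T})"
        using has_vector_derivative_Pair[OF du'[OF t] dv'[OF t]] by (simp add: G_def w'[OF t])
    qed
    then have "l2_of D (u' t) = U t" by (simp add: U_def prod_eq_iff)
    \<comment> \<open>The constructed \<open>u t\<close> represents the projection of
      \<open>U t\<close>, so both sides are compared after projecting; the class of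
      \<open>u' t\<close> is unchanged by this.\<close>
    then have "l2_of D (u' t) = l2_of D (u t)"
      using restrict_l2_of[OF D L2'(1)[OF t]] by (simp add: l2u)
    then show ?thesis
      using l2_of_eq_iff[OF D L2'(1)[OF t] u_L2] by simp
  qed
  with sol show ?thesis by blast
qed

end

section \<open>The body force\<close>

definition reflect :: "real^2 \<Rightarrow> real^2" where
  "reflect x = vector [x$1, - x$2]"

lemma reflect_component [simp]: "reflect x $ 1 = x $ 1" "reflect x $ 2 = - x $ 2"
  by (simp_all add: reflect_def)

lemma borel_measurable_vec_nth2 [measurable]: "(\<lambda>x::real^2. x $ i) \<in> borel_measurable borel"
  by (intro borel_measurable_continuous_onI continuous_intros)

lemma borel_measurable_reflect: "reflect \<in> borel_measurable borel"
proof (rule borel_measurable_continuous_onI)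
  have eq: "reflect = (\<lambda>x. (x$1) *\<^sub>R axis 1 1 + (- x$2) *\<^sub>R axis 2 1)"
    by (simp add: fun_eq_iff vec_eq_iff forall_2 axis_def)
  show "continuous_on UNIV reflect"
    unfolding eq by (intro continuous_intros)
qed

text \<open>The reflection is a diagonal linear map with entries 1 and -1, so its Jacobian factor,
  the product of their absolute values, is 1.\<close>

lemma integral_lborel_reflect:
  fixes f :: "real^2 \<Rightarrow> real"
  assumes [measurable]: "f \<in> borel_measurable borel"
  shows "(LINT x|lborel. f (reflect x)) = (LINT x|lborel. f x)"
proof -
  define c where "c j = (if j = axis 2 1 then - 1 else 1 :: real)" for j :: "real^2"
  have nz: "c j \<noteq> 0" for j
    by (simp add: c_def)
  have eq: "reflect = (\<lambda>x. 0 + (\<Sum>j\<in>Basis. (c j * (x \<bullet> j)) *\<^sub>R j))"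
  proof
    fix x
    have "reflect x \<bullet> b = (\<Sum>j\<in>Basis. (c j * (x \<bullet> j)) *\<^sub>R j) \<bullet> b" if "b \<in> Basis" for b
    proof -
      have "\<exists>i. b = axis i 1"
        using that by (auto simp: Basis_vec_def)
      then obtain i where b: "b = axis i 1" ..
      have "(\<Sum>j\<in>Basis. (c j * (x \<bullet> j)) *\<^sub>R j) \<bullet> b = c b * (x \<bullet> b)"
        using that by (rule inner_sum_left_Basis)
      also have "\<dots> = reflect x \<bullet> b"
        using exhaust_2[of i] by (auto simp: b c_def inner_axis axis_eq_axis)
      finally show ?thesis ..
    qed
    then show "reflect x = 0 + (\<Sum>j\<in>Basis. (c j * (x \<bullet> j)) *\<^sub>R j)"
      by (simp add: euclidean_eq_iff[of "reflect x"])
  qed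
  have "lborel = density (distr lborel borel reflect) (\<lambda>_. (\<Prod>j\<in>Basis. \<bar>c j\<bar>))"
    unfolding eq by (rule lborel_affine_euclidean[OF nz])
  moreover have "(\<Prod>j\<in>Basis. \<bar>c j\<bar>) = 1"
    by (rule prod.neutral) (simp add: c_def)
  ultimately have "lborel = distr lborel borel reflect"
    by (simp add: density_1)
  then have "(LINT x|lborel. f x) = (LINT x|distr lborel borel reflect. f x)"
    by simp
  also have "\<dots> = (LINT x|lborel. f (reflect x))"
    using borel_measurable_reflect by (intro integral_distr) simp_all
  finally show ?thesis ..
qed

text \<open>The integral equals its own negative. Borel measurability of the extension by zero moves
  it from the completed measure to \<open>lborel\<close>, where the change of variables is
  available.\<close>

lemma integral_lebesgue_on_reflect_odd:
  fixes f :: "real^2 \<Rightarrow> real"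
  assumes D: "D \<in> sets borel" and sym: "\<And>x. reflect x \<in> D \<longleftrightarrow> x \<in> D"
    and f: "(\<lambda>x. indicator D x *\<^sub>R f x) \<in> borel_measurable borel"
    and odd: "\<And>x. x \<in> D \<Longrightarrow> f (reflect x) = - f x"
  shows "(LINT x|lebesgue_on D. f x) = 0"
proof -
  let ?h = "\<lambda>x. indicator D x *\<^sub>R f x"
  have "(LINT x|lebesgue_on D. f x) = (LINT x|lebesgue. ?h x)"
    using D by (simp add: integral_restrict_space)
  also have "\<dots> = (LINT x|lborel. ?h x)"
    using f by (intro integral_completion) simp
  finally have eq: "(LINT x|lebesgue_on D. f x) = (LINT x|lborel. ?h x)" .
  have "?h (reflect x) = - ?h x" for x
    using odd sym by (simp add: indicator_def)
  then have "(LINT x|lborel. ?h x) = - (LINT x|lborel. ?h x)"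
    using integral_lborel_reflect[OF f] by simp
  then show ?thesis using eq by simp
qed

lemma L2dot_cong:
  assumes "\<And>x. x \<in> D \<Longrightarrow> f x = g x" "f \<in> L2dot D"
  shows "g \<in> L2dot D"
proof -
  have sp: "\<And>x. x \<in> space (lebesgue_on D) \<Longrightarrow> f x = g x"
    using assms(1) by simp
  have "f \<in> borel_measurable (lebesgue_on D) \<longleftrightarrow> g \<in> borel_measurable (lebesgue_on D)"
    by (intro measurable_cong sp)
  moreover have "integrable (lebesgue_on D) (\<lambda>x. (norm (f x))\<^sup>2)
      \<longleftrightarrow> integrable (lebesgue_on D) (\<lambda>x. (norm (g x))\<^sup>2)"
    by (intro Bochner_Integration.integrable_cong) (simp_all add: sp)
  moreover have "(LINT x|lebesgue_on D. f x \<bullet> r x) = (LINT x|lebesgue_on D. g x \<bullet> r x)" for r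
    by (intro Bochner_Integration.integral_cong) (simp_all add: sp)
  ultimately show ?thesis
    using assms(2) by (simp add: L2dot_def L2_def)
qed

lemma L2dot_subset: "f \<in> L2dot D \<Longrightarrow> f \<in> L2 D"
  by (simp add: L2dot_def)

section \<open>Vertical loads that are odd across the midline\<close>

context bond_model
begin

lemma L2_norm_le:
  assumes "\<And>x. x \<in> D \<Longrightarrow> norm (f x) \<le> B" "B \<ge> 0" "f \<in> L2 D"
  shows "L2_norm D f \<le> B * sqrt (measure (lebesgue_on D) D)"
proof -
  have "(LINT x|lebesgue_on D. (norm (f x))\<^sup>2) \<le> (LINT x|lebesgue_on D. B\<^sup>2)"
    using assms by (intro integral_mono) (auto simp: L2_def power_mono)
  then have "L2_norm D f \<le> sqrt (B\<^sup>2 * measure (lebesgue_on D) D)"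
    by (simp add: L2_norm_def mult.commute)
  then show ?thesis using assms(2) by (simp add: real_sqrt_mult)
qed

text \<open>A vertical load meets only the second component \<open>\<Omega> * x$1 + c$2\<close> of a
  rigid motion, which does not depend on \<open>x$2\<close>. The work density is therefore odd under
  the reflection and integrates to 0 over the symmetric domain.\<close>

lemma antisymmetric_load_L2dot:
  assumes strip: "\<And>x. x \<in> D \<Longrightarrow> x$1 \<in> {0..a}" and sym: "\<And>x. reflect x \<in> D \<longleftrightarrow> x \<in> D"
    and p: "continuous_on {0..a} p" and q [measurable]: "q \<in> borel_measurable borel"
    and q_odd: "\<And>s. q (- s) = - q s" and q_le: "\<And>s. \<bar>q s\<bar> \<le> 1"
  shows "(\<lambda>x. (p (x$1) * q (x$2)) *\<^sub>R axis 2 1) \<in> L2dot D"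
proof -
  note [measurable] = D_borel
  have p_D: "continuous_on D (\<lambda>x. p (x$1))"
    using strip by (intro continuous_on_compose2[OF p] continuous_intros) auto
  have pm [measurable]: "(\<lambda>x. indicator D x * p (x$1)) \<in> borel_measurable borel"
    using borel_measurable_continuous_on_indicator[OF D_borel p_D] by simp
  have meas: "(\<lambda>x. (p (x$1) * q (x$2)) *\<^sub>R (axis 2 1 :: real^2)) \<in> borel_measurable (lebesgue_on D)"
  proof -
    have "(\<lambda>x. p (x$1)) \<in> borel_measurable (lebesgue_on D)"
      using p_D D_lebesgue by (rule continuous_imp_measurable_on_sets_lebesgue)
    moreover have "(\<lambda>x. q (x$2)) \<in> borel_measurable (lebesgue_on D)"
      by (rule measurable_compose[OF lebesgue_on_id_measurable]) measurable
    ultimately show ?thesis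
      by (intro borel_measurable_scaleR borel_measurable_times) simp_all
  qed
  have "bounded (p ` {0..a})"
    using p by (intro compact_imp_bounded compact_continuous_image) auto
  then obtain B where B: "\<forall>s\<in>{0..a}. \<bar>p s\<bar> \<le> B"
    by (auto simp: bounded_iff)
  have "norm ((p (x$1) * q (x$2)) *\<^sub>R axis 2 (1::real) :: real^2) \<le> B" if "x \<in> D" for x
  proof -
    have "\<bar>p (x$1)\<bar> * \<bar>q (x$2)\<bar> \<le> \<bar>p (x$1)\<bar> * 1"
      by (intro mult_left_mono q_le) simp
    then show ?thesis using bspec[OF B strip[OF that]] by (simp add: abs_mult norm_axis_1)
  qed
  with meas have L2: "(\<lambda>x. (p (x$1) * q (x$2)) *\<^sub>R axis 2 1) \<in> L2 D"
    by (rule bounded_measurable_L2)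
  have "(LINT x|lebesgue_on D. ((p (x$1) * q (x$2)) *\<^sub>R axis 2 1) \<bullet> rigid_motion \<Omega> c x) = 0" for \<Omega> c
  proof (rule integral_lebesgue_on_reflect_odd[OF D_borel sym])
    have eq: "((p (x$1) * q (x$2)) *\<^sub>R axis 2 1) \<bullet> rigid_motion \<Omega> c x = p (x$1) * q (x$2) * (\<Omega> * x$1 + c$2)" for x
      by (simp add: rigid_motion_def inner_axis')
    show "((p (reflect x $ 1) * q (reflect x $ 2)) *\<^sub>R axis 2 1) \<bullet> rigid_motion \<Omega> c (reflect x)
        = - (((p (x$1) * q (x$2)) *\<^sub>R axis 2 1) \<bullet> rigid_motion \<Omega> c x)" for x
      unfolding eq by (simp add: q_odd)
    have "(\<lambda>x. (indicator D x * p (x$1)) * (q (x$2) * (\<Omega> * x$1 + c$2))) \<in> borel_measurable borel"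
      by measurable
    then show "(\<lambda>x. indicator D x *\<^sub>R (((p (x$1) * q (x$2)) *\<^sub>R axis 2 1) \<bullet> rigid_motion \<Omega> c x)) \<in> borel_measurable borel"
      unfolding eq by (simp add: mult.assoc)
  qed
  with L2 show ?thesis by (simp add: L2dot_def)
qed

text \<open>Uniform continuity of \<open>p\<close> on the compact rectangle makes the load
  continuous in time uniformly over \<open>D\<close>; finite area turns the uniform estimate into
  one in \<open>L2_norm\<close>.\<close>

lemma continuous_on_load:
  fixes p :: "real \<times> real \<Rightarrow> real"
  assumes strip: "\<And>x. x \<in> D \<Longrightarrow> x$1 \<in> {0..a}"
    and p: "continuous_on ({0..a} \<times> {0..T}) p" and q_le: "\<And>s. \<bar>q s\<bar> \<le> 1"
    and F_L2: "\<And>t. t \<in> {0..T} \<Longrightarrow> (\<lambda>x. F x t) \<in> L2 D"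
    and F: "\<And>x t. x \<in> D \<Longrightarrow> t \<in> {0..T} \<Longrightarrow> F x t = (p (x$1, t) * q (x$2)) *\<^sub>R axis 2 1"
  shows "continuous_on {0..T} (\<lambda>t. l2_of D (\<lambda>x. F x t))"
proof -
  define m where "m = sqrt (measure (lebesgue_on D) D)"
  have m: "m \<ge> 0" by (simp add: m_def)
  have unif: "uniformly_continuous_on ({0..a} \<times> {0..T}) p"
    using p by (intro compact_uniformly_continuous) (auto intro: compact_Times)
  show ?thesis
    unfolding continuous_on_iff
  proof (intro ballI allI impI)
    fix t e :: real
    assume t: "t \<in> {0..T}" and e: "0 < e"
    \<comment> \<open>Adding 1 avoids division by zero when \<open>m = 0\<close> and makes
      \<open>\<eta> * m < e\<close> strict.\<close>
    define \<eta> where "\<eta> = e / (m + 1)"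
    have \<eta>: "\<eta> > 0" using e m by (simp add: \<eta>_def)
    obtain d where d: "d > 0" and close: "\<And>z z'. z \<in> {0..a} \<times> {0..T} \<Longrightarrow> z' \<in> {0..a} \<times> {0..T} \<Longrightarrow>
        dist z' z < d \<Longrightarrow> dist (p z') (p z) < \<eta>"
      using unif \<eta> unfolding uniformly_continuous_on_def by blast
    have "dist (l2_of D (\<lambda>x. F x s)) (l2_of D (\<lambda>x. F x t)) < e"
      if s: "s \<in> {0..T}" and st: "dist s t < d" for s
    proof -
      have "norm (F x s - F x t) \<le> \<eta>" if x: "x \<in> D" for x
      proof -
        have "\<bar>p (x$1, s) - p (x$1, t)\<bar> \<le> \<eta>"
          using close[of "(x$1, t)" "(x$1, s)"] strip[OF x] s t st
          by (simp add: dist_Pair_Pair dist_real_def)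
        moreover have "F x s - F x t = ((p (x$1, s) - p (x$1, t)) * q (x$2)) *\<^sub>R axis 2 1"
          using F[OF x s] F[OF x t] by (simp add: algebra_simps)
        then have "norm (F x s - F x t) = \<bar>p (x$1, s) - p (x$1, t)\<bar> * \<bar>q (x$2)\<bar>"
          by (simp add: abs_mult norm_axis_1)
        moreover have "\<bar>p (x$1, s) - p (x$1, t)\<bar> * \<bar>q (x$2)\<bar> \<le> \<bar>p (x$1, s) - p (x$1, t)\<bar> * 1"
          by (intro mult_left_mono q_le) simp
        ultimately show ?thesis by simp
      qed
      then have "L2_norm D (\<lambda>x. F x s - F x t) \<le> \<eta> * m"
        unfolding m_def using \<eta> F_L2[OF s] F_L2[OF t] by (intro L2_norm_le L2_diff) simp_all
      also have "\<dots> < e"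
        using e m by (simp add: \<eta>_def field_simps)
      finally show ?thesis
        using D_lebesgue F_L2[OF s] F_L2[OF t] by (simp add: dist_norm norm_l2_of_diff)
    qed
    with d show "\<exists>d>0. \<forall>s\<in>{0..T}. dist s t < d \<longrightarrow>
        dist (l2_of D (\<lambda>x. F x s)) (l2_of D (\<lambda>x. F x t)) < e"
      by blast
  qed
qed

end

section \<open>The plate and its loaded layers\<close>

lemma notched_plate_borel: "notched_plate a b l0 d \<in> sets borel"
  unfolding notched_plate_def plate_def notch_def by measurable

lemma notched_plate_bounded: "bounded (notched_plate a b l0 d)"
proof (rule bounded_subset)
  show "bounded (cbox (vector [0, - b/2]) (vector [a, b/2]) :: (real^2) set)"
    by (rule bounded_cbox)
  show "notched_plate a b l0 d \<subseteq> cbox (vector [0, - b/2]) (vector [a, b/2])"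
    by (auto simp: notched_plate_def plate_def mem_box_cart forall_2)
qed

lemma notched_plate_reflect: "reflect x \<in> notched_plate a b l0 d \<longleftrightarrow> x \<in> notched_plate a b l0 d"
  by (auto simp: notched_plate_def plate_def notch_def)

text \<open>The outer plate bounds are omitted, since only points of the plate are inserted. Where
  the layers overlap, for \<open>\<delta> > b/2\<close>, the two terms cancel, just as the opposite
  forces do.\<close>

definition layer :: "real \<Rightarrow> real \<Rightarrow> real \<Rightarrow> real" where
  "layer b \<delta> s = (if b/2 - \<delta> < s then 1 else 0) - (if s < - b/2 + \<delta> then 1 else 0)"

lemma layer_properties:
  "layer b \<delta> \<in> borel_measurable borel"
  "layer b \<delta> (- s) = - layer b \<delta> s"
  "\<bar>layer b \<delta> s\<bar> \<le> 1"
proof -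
  show "layer b \<delta> \<in> borel_measurable borel"
    unfolding layer_def by measurable
qed (auto simp: layer_def)

lemma body_force_plate:
  assumes "x \<in> plate a b" "gm (x$1, t) = - gp (x$1, t)"
  shows "body_force a b \<delta> gp gm x t = (gp (x$1, t) / \<delta> * layer b \<delta> (x$2)) *\<^sub>R axis 2 1"
  using assms by (simp add: body_force_def plate_def layer_def)

theorem proposition8:
  fixes a b l0 d \<delta> T \<epsilon> \<rho> M\<^sub>J r\<^sub>c r\<^sub>p C\<^sub>p :: real
    and D :: "(real^2) set"
    and J g h :: "real \<Rightarrow> real"
    and gp gm :: "real \<times> real \<Rightarrow> real"
    and u0 v0 :: "real^2 \<Rightarrow> real^2"
  assumes "a > 0" and "b > 0" and "d > 0"
    and "D = notched_plate a b l0 d"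
    and "T > 0" and "\<epsilon> > 0" and "\<rho> > 0"
    and "J \<in> borel_measurable borel"
    and "\<And>r. r \<ge> 1 \<Longrightarrow> J r = 0"
    and "\<And>r. 0 \<le> r \<Longrightarrow> r < 1 \<Longrightarrow> 0 \<le> J r \<and> J r \<le> M\<^sub>J"
    and "concave_on {0..} h"
    and "\<And>r. g r = h (r\<^sup>2)"
    and "smooth_on UNIV g" and "bounded (range g)"
    and "g 0 = 0" and "deriv g 0 = 0"
    and "0 < r\<^sub>c" and "r\<^sub>c < r\<^sub>p"
    and "convex_on {- r\<^sub>c..r\<^sub>c} g"
    and "concave_on {r\<^sub>c..} g" and "concave_on {..- r\<^sub>c} g"
    and "(g \<longlongrightarrow> C\<^sub>p) at_infinity"
    and "deriv g r\<^sub>p = 0" and "deriv g (- r\<^sub>p) = 0"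
    and "\<delta> > 0"
    and "smooth_on ({0..a} \<times> {0..T}) gp" and "smooth_on ({0..a} \<times> {0..T}) gm"
    and "\<And>s t. s \<in> {0..a} \<Longrightarrow> t \<in> {0..T} \<Longrightarrow> gm (s, t) = - gp (s, t)"
    and "\<And>s t. s \<in> {0<..<a} \<Longrightarrow> t \<in> {0..T} \<Longrightarrow> gp (s, t) > 0"
    and "(SUP t\<in>{0..T}. \<integral>\<^sup>+ x. ennreal ((norm (body_force a b \<delta> gp gm x t))\<^sup>2) \<partial>lebesgue_on D) < \<infinity>"
    and "u0 \<in> L2dot D" and "v0 \<in> L2dot D"
  shows "\<exists>u. is_solution D J g \<epsilon> \<rho> (body_force a b \<delta> gp gm) u0 v0 T u \<and>
           (\<forall>u'. is_solution D J g \<epsilon> \<rho> (body_force a b \<delta> gp gm) u0 v0 T u' \<longrightarrow>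
             (\<forall>t\<in>{0..T}. AE x in lebesgue_on D. u' t x = u t x))"
proof -
  let ?F = "body_force a b \<delta> gp gm"
  have even: "g (- x) = g x" for x
    by (simp add: \<open>\<And>r. g r = h (r\<^sup>2)\<close>)
  \<comment> \<open>The critical point \<open>r\<^sub>p\<close> lies strictly inside the concave
    branch starting at \<open>r\<^sub>c\<close>, so \<open>deriv g\<close> vanishes from there
    on.\<close>
  obtain L where L: "L > 0" "\<forall>x. \<bar>deriv g x\<bar> \<le> L"
      "\<forall>x y. \<bar>deriv g x - deriv g y\<bar> \<le> L * \<bar>x - y\<bar>"
    using deriv_bounded_Lipschitz[OF \<open>smooth_on UNIV g\<close> even \<open>bounded (range g)\<close>
        \<open>concave_on {r\<^sub>c..} g\<close> \<open>r\<^sub>c < r\<^sub>p\<close> \<open>deriv g r\<^sub>p = 0\<close>] by blast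
  have D: "D \<in> sets borel" "bounded D"
    unfolding \<open>D = _\<close> by (rule notched_plate_borel notched_plate_bounded)+
  interpret bond_model D J g \<epsilon> M\<^sub>J L
    by (rule bond_model.intro[OF D \<open>\<epsilon> > 0\<close> \<open>J \<in> borel_measurable borel\<close> assms(9,10)
        smooth_on_UNIV_derivs(1)[OF \<open>smooth_on UNIV g\<close>] L(1) spec[OF L(2)] spec[OF spec[OF L(3)]]])
  have D_plate: "x \<in> plate a b" if "x \<in> D" for x
    using that \<open>D = _\<close> by (simp add: notched_plate_def)
  have strip: "x$1 \<in> {0..a}" if "x \<in> D" for x
    using D_plate[OF that] by (simp add: plate_def)
  have sym: "reflect x \<in> D \<longleftrightarrow> x \<in> D" for x
    unfolding \<open>D = _\<close> by (rule notched_plate_reflect)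
  have F: "?F x t = (gp (x$1, t) / \<delta> * layer b \<delta> (x$2)) *\<^sub>R axis 2 1"
    if "x \<in> D" "t \<in> {0..T}" for x t
    using that by (intro body_force_plate D_plate assms(28) strip)
  have gp: "continuous_on ({0..a} \<times> {0..T}) gp"
    using spec[OF \<open>smooth_on ({0..a} \<times> {0..T}) gp\<close>[unfolded smooth_on_def], of 0] by simp
  \<comment> \<open>The product form of the body force is available only on \<open>D\<close>, hence
    the transfer by congruence.\<close>
  have F_L2dot: "(\<lambda>x. ?F x t) \<in> L2dot D" if t: "t \<in> {0..T}" for t
  proof (rule L2dot_cong)
    have p: "continuous_on {0..a} (\<lambda>s. gp (s, t) / \<delta>)"
      using t \<open>\<delta> > 0\<close> by (intro continuous_intros continuous_on_compose2[OF gp]) auto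
    show "(\<lambda>x. (gp (x$1, t) / \<delta> * layer b \<delta> (x$2)) *\<^sub>R axis 2 1) \<in> L2dot D"
      by (intro antisymmetric_load_L2dot[where a = a and p = "\<lambda>s. gp (s, t) / \<delta>"] strip sym p layer_properties)
  qed (rule F[OF _ t, symmetric])
  have p: "continuous_on ({0..a} \<times> {0..T}) (\<lambda>z. gp z / \<delta>)"
    using \<open>\<delta> > 0\<close> by (intro continuous_intros gp) simp
  have "continuous_on {0..T} (\<lambda>t. l2_of D (\<lambda>x. ?F x t))"
    by (intro continuous_on_load[where a = a and p = "\<lambda>z. gp z / \<delta>" and q = "layer b \<delta>"]
        strip p layer_properties(3) L2dot_subset F_L2dot F)
  then show ?thesis
    using \<open>\<rho> > 0\<close> \<open>T > 0\<close> F_L2dot \<open>u0 \<in> L2dot D\<close> \<open>v0 \<in> L2dot D\<close>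
    by (intro initial_value_problem) simp_all
qed

end
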